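(* Let $K$ be a field and let $\mathcal{R}$ be the $9$-dimensional $K$-algebra with basis $\{E,X_1,X_2,Y_1,Y_2\}\cup\{F_{ij}\mid 1\le i,j\le 2\}$ and multiplication given by $E^2=E$, $F_{ij}F_{jr}=F_{ir}$, $EX_i=X_i$, $X_iF_{ir}=X_r$, $F_{ij}Y_j=Y_i$, $Y_iE=Y_i$ for all $1\le i,j,r\le 2$, any other product of two basis elements being zero. Then $[\mathcal{R}^*]$ has order $2$ in $\mathrm{Pic}(\mathcal{R})$. Any invertible $\mathcal{R}$-bimodule is isomorphic either to ${}_1\mathcal{R}_\alpha$ or to ${}_1{\mathcal{R}^*}_\alpha$ for some $\alpha\in\mathrm{Aut}(\mathcal{R})$, and $\mathrm{Pic}(\mathcal{R})\simeq\mathrm{Out}(\mathcal{R})\times C_2$, where $C_2$ is the cyclic group of order $2$.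
   Context: Algebras are associative unital $K$-algebras, and bimodules are bimodules on which $K$ acts centrally. For an algebra $R$, an $R$-bimodule $P$ is invertible if there is an $R$-bimodule $Q$ with $P\otimes_R Q\simeq R\simeq Q\otimes_R P$ as bimodules; $\mathrm{Pic}(R)$ is the group of isomorphism classes $[P]$ of invertible $R$-bimodules, with $[U][V]=[U\otimes_R V]$. $\mathrm{Aut}(R)$ is the group of $K$-algebra automorphisms of $R$, $\mathrm{Inn}(R)$ the normal subgroup of inner automorphisms $r\mapsto u^{-1}ru$ ($u\in R$ invertible), and $\mathrm{Out}(R)=\mathrm{Aut}(R)/\mathrm{Inn}(R)$. $R^*=\mathrm{Hom}_K(R,K)$ is an $R$-bimodule by $(r\rightharpoonup r^* )(a)=r^*(ar)$ and $(r^*\leftharpoonup r)(a)=r^*(ra)$. For an $R$-bimodule $V$ and $\alpha\in\mathrm{Aut}(R)$, ${}_1V_\alpha$ is the bimodule with the same underlying space and left action as $V$ and with right action $v\ast r=v\alpha(r)$. *)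

theory Defs
  imports "HOL-Algebra.Algebra"
begin

section \<open>Algebras over a field\<close>

locale k_algebra = vector_space scale
  for scale :: "'k::field \<Rightarrow> 'r::ring_1 \<Rightarrow> 'r" +
  assumes scale_mult_left: "scale k a * b = scale k (a * b)"
    and scale_mult_right: "a * scale k b = scale k (a * b)"

definition alg_auts :: "('k::field \<Rightarrow> 'r::ring_1 \<Rightarrow> 'r) \<Rightarrow> ('r \<Rightarrow> 'r) set" where
  "alg_auts scale =
     {\<alpha>. bij \<alpha> \<and> Vector_Spaces.linear scale scale \<alpha> \<and> \<alpha> 1 = 1 \<and> (\<forall>a b. \<alpha> (a * b) = \<alpha> a * \<alpha> b)}"

definition Aut_alg :: "('k::field \<Rightarrow> 'r::ring_1 \<Rightarrow> 'r) \<Rightarrow> ('r \<Rightarrow> 'r) monoid" where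
  "Aut_alg scale = \<lparr>carrier = alg_auts scale, monoid.mult = (\<circ>), one = id\<rparr>"

definition Inn_alg :: "('r::ring_1 \<Rightarrow> 'r) set" where
  "Inn_alg = {(\<lambda>r. v * r * u) | u v. u * v = 1 \<and> v * u = 1}"

definition Out_alg :: "('k::field \<Rightarrow> 'r::ring_1 \<Rightarrow> 'r) \<Rightarrow> ('r \<Rightarrow> 'r) set monoid" where
  "Out_alg scale = Aut_alg scale Mod Inn_alg"


section \<open>Bimodules\<close>

text \<open>The underlying abelian group of a bimodule is written in the multiplicative notation
  of \<^typ>\<open>'m monoid\<close>, as for \<^const>\<open>free_Abelian_group\<close>:
  \<^const>\<open>monoid.mult\<close> is the addition and \<^const>\<open>monoid.one\<close> is the zero element.\<close>

record ('r, 'm) bimod = "'m monoid" +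
  lact :: "'r \<Rightarrow> 'm \<Rightarrow> 'm"
  ract :: "'m \<Rightarrow> 'r \<Rightarrow> 'm"

text \<open>The \<open>K\<close>-structure of a bimodule is the one induced by \<open>R\<close>; the axiom \<open>central\<close> says
  that the structures induced from the left and from the right coincide. In particular every
  bimodule homomorphism is \<open>K\<close>-linear.\<close>

locale bimodule = k_algebra scale + comm_group M
  for scale :: "'k::field \<Rightarrow> 'r::ring_1 \<Rightarrow> 'r" and M :: "('r, 'm) bimod" (structure) +
  assumes lact_closed: "m \<in> carrier M \<Longrightarrow> lact M r m \<in> carrier M"
    and lact_add: "\<lbrakk>m \<in> carrier M; n \<in> carrier M\<rbrakk> \<Longrightarrow> lact M r (m \<otimes> n) = lact M r m \<otimes> lact M r n"
    and add_lact: "m \<in> carrier M \<Longrightarrow> lact M (r + s) m = lact M r m \<otimes> lact M s m"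
    and lact_mult: "m \<in> carrier M \<Longrightarrow> lact M (r * s) m = lact M r (lact M s m)"
    and lact_one: "m \<in> carrier M \<Longrightarrow> lact M 1 m = m"
    and ract_closed: "m \<in> carrier M \<Longrightarrow> ract M m r \<in> carrier M"
    and ract_add: "\<lbrakk>m \<in> carrier M; n \<in> carrier M\<rbrakk> \<Longrightarrow> ract M (m \<otimes> n) r = ract M m r \<otimes> ract M n r"
    and add_ract: "m \<in> carrier M \<Longrightarrow> ract M m (r + s) = ract M m r \<otimes> ract M m s"
    and ract_mult: "m \<in> carrier M \<Longrightarrow> ract M m (r * s) = ract M (ract M m r) s"
    and ract_one: "m \<in> carrier M \<Longrightarrow> ract M m 1 = m"
    and lact_ract: "m \<in> carrier M \<Longrightarrow> ract M (lact M r m) s = lact M r (ract M m s)"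
    and central: "m \<in> carrier M \<Longrightarrow> lact M (scale k 1) m = ract M m (scale k 1)"

definition bimod_iso :: "('r, 'm) bimod \<Rightarrow> ('r, 'n) bimod \<Rightarrow> bool" (infix "\<simeq>\<^sub>b" 50) where
  "M \<simeq>\<^sub>b N \<longleftrightarrow> (\<exists>f \<in> iso M N. \<forall>m \<in> carrier M. \<forall>r.
     f (lact M r m) = lact N r (f m) \<and> f (ract M m r) = ract N (f m) r)"

definition regular_bimod :: "('r::ring_1, 'r) bimod" where
  "regular_bimod = \<lparr>carrier = UNIV, monoid.mult = (+), one = 0, lact = (*), ract = (*)\<rparr>"

definition dual_bimod :: "('k::field \<Rightarrow> 'r::ring_1 \<Rightarrow> 'r) \<Rightarrow> ('r, 'r \<Rightarrow> 'k) bimod" where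
  "dual_bimod scale =
     \<lparr>carrier = {f. Vector_Spaces.linear scale (*) f},
      monoid.mult = (\<lambda>f g a. f a + g a), one = (\<lambda>_. 0),
      lact = (\<lambda>r f a. f (a * r)), ract = (\<lambda>f r a. f (r * a))\<rparr>"

definition twist_bimod :: "('r, 'm) bimod \<Rightarrow> ('r \<Rightarrow> 'r) \<Rightarrow> ('r, 'm) bimod" where
  "twist_bimod V \<alpha> = V\<lparr>ract := (\<lambda>v r. ract V v (\<alpha> r))\<rparr>"


section \<open>Tensor product of bimodules\<close>

definition tensor_free :: "('r, 'p) bimod \<Rightarrow> ('r, 'q) bimod \<Rightarrow> ('p \<times> 'q \<Rightarrow>\<^sub>0 int) monoid" where
  "tensor_free P Q = free_Abelian_group (carrier P \<times> carrier Q)"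

definition tensor_rels :: "('r, 'p) bimod \<Rightarrow> ('r, 'q) bimod \<Rightarrow> ('p \<times> 'q \<Rightarrow>\<^sub>0 int) set" where
  "tensor_rels P Q =
     {frag_of (p \<otimes>\<^bsub>P\<^esub> p', q) - (frag_of (p, q) + frag_of (p', q)) | p p' q.
        p \<in> carrier P \<and> p' \<in> carrier P \<and> q \<in> carrier Q} \<union>
     {frag_of (p, q \<otimes>\<^bsub>Q\<^esub> q') - (frag_of (p, q) + frag_of (p, q')) | p q q'.
        p \<in> carrier P \<and> q \<in> carrier Q \<and> q' \<in> carrier Q} \<union>
     {frag_of (ract P p r, q) - frag_of (p, lact Q r q) | p r q.
        p \<in> carrier P \<and> q \<in> carrier Q}"

definition tensor_null :: "('r, 'p) bimod \<Rightarrow> ('r, 'q) bimod \<Rightarrow> ('p \<times> 'q \<Rightarrow>\<^sub>0 int) set" where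
  "tensor_null P Q = generate (tensor_free P Q) (tensor_rels P Q)"

text \<open>\<open>P \<otimes>\<^sub>R Q\<close>. The actions are induced by \<open>r (p \<otimes> q) = r p \<otimes> q\<close> and
  \<open>(p \<otimes> q) r = p \<otimes> q r\<close>. The union in \<open>lact\<close> and \<open>ract\<close> runs over the representatives
  of the class \<open>C\<close>, all of which give the same class.\<close>

definition tensor_bimod ::
    "('r, 'p) bimod \<Rightarrow> ('r, 'q) bimod \<Rightarrow> ('r, ('p \<times> 'q \<Rightarrow>\<^sub>0 int) set) bimod" where
  "tensor_bimod P Q =
     (let F = tensor_free P Q; H = tensor_null P Q in
      \<lparr>carrier = carrier (F Mod H), monoid.mult = monoid.mult (F Mod H), one = one (F Mod H),
       lact = (\<lambda>r C. \<Union>x\<in>C. H #>\<^bsub>F\<^esub> frag_extend (\<lambda>(p, q). frag_of (lact P r p, q)) x),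
       ract = (\<lambda>C r. \<Union>x\<in>C. H #>\<^bsub>F\<^esub> frag_extend (\<lambda>(p, q). frag_of (p, ract Q q r)) x)\<rparr>)"


section \<open>Invertible bimodules and the Picard group\<close>

text \<open>The type of the carrier of the inverse bimodule is a parameter, because HOL does not
  allow an existential quantifier over types.\<close>

definition invertible_bimod ::
    "'q itself \<Rightarrow> ('k::field \<Rightarrow> 'r::ring_1 \<Rightarrow> 'r) \<Rightarrow> ('r, 'p) bimod \<Rightarrow> bool" where
  "invertible_bimod _ scale P \<longleftrightarrow> bimodule scale P \<and>
     (\<exists>Q :: ('r, 'q) bimod. bimodule scale Q \<and>
        tensor_bimod P Q \<simeq>\<^sub>b regular_bimod \<and> regular_bimod \<simeq>\<^sub>b tensor_bimod Q P)"

text \<open>The Picard group is formed from the bimodules whose carrier is a subset of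
  \<^typ>\<open>nat \<Rightarrow> 'r\<close>. Nothing is lost: an invertible bimodule is finitely generated as a left
  module, hence its carrier has the cardinality of a quotient of some \<open>R\<^sup>n\<close> and embeds
  into \<^typ>\<open>nat \<Rightarrow> 'r\<close>; the same applies to its inverse.\<close>

type_synonym 'r small_bimod = "('r, nat \<Rightarrow> 'r) bimod"

text \<open>The isomorphism class of \<open>M\<close>, where \<open>M\<close> itself may have a carrier in any type.\<close>

definition bimod_class ::
    "('k::field \<Rightarrow> 'r::ring_1 \<Rightarrow> 'r) \<Rightarrow> ('r, 'm) bimod \<Rightarrow> 'r small_bimod set" where
  "bimod_class scale M = {N. bimodule scale N \<and> N \<simeq>\<^sub>b M}"

definition Pic :: "('k::field \<Rightarrow> 'r::ring_1 \<Rightarrow> 'r) \<Rightarrow> 'r small_bimod set monoid" where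
  "Pic scale =
     \<lparr>carrier = {bimod_class scale P | P :: 'r small_bimod.
                   invertible_bimod TYPE(nat \<Rightarrow> 'r) scale P},
      monoid.mult = (\<lambda>A B. \<Union>U\<in>A. \<Union>V\<in>B. bimod_class scale (tensor_bimod U V)),
      one = bimod_class scale regular_bimod\<rparr>"


section \<open>The nine-dimensional algebra\<close>

datatype idx = I1 | I2

datatype bas = BE | BX idx | BY idx | BF idx idx

text \<open>Product of two basis elements; \<^const>\<open>None\<close> stands for \<open>0\<close>.\<close>

fun bprod :: "bas \<Rightarrow> bas \<Rightarrow> bas option" where
  "bprod BE BE = Some BE"
| "bprod (BF i j) (BF j' r) = (if j = j' then Some (BF i r) else None)"
| "bprod BE (BX i) = Some (BX i)"
| "bprod (BX i) (BF i' r) = (if i = i' then Some (BX r) else None)"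
| "bprod (BF i j) (BY j') = (if j = j' then Some (BY i) else None)"
| "bprod (BY i) BE = Some (BY i)"
| "bprod _ _ = None"

lemma UNIV_idx: "UNIV = {I1, I2}"
  using idx.exhaust by auto

instance idx :: finite
  by standard (simp add: UNIV_idx)

lemma UNIV_bas: "UNIV = {BE, BX I1, BX I2, BY I1, BY I2, BF I1 I1, BF I1 I2, BF I2 I1, BF I2 I2}"
proof -
  have "UNIV = {BE} \<union> range BX \<union> range BY \<union> range (\<lambda>(i, j). BF i j)"
    using bas.exhaust by (auto simp: image_iff) metis
  then show ?thesis
    by (simp add: UNIV_idx UNIV_Times_UNIV [symmetric] insert_commute del: UNIV_Times_UNIV)
qed

instance bas :: finite
  by standard (simp add: UNIV_bas)

text \<open>Elements are coordinate vectors with respect to the basis \<^typ>\<open>bas\<close>.\<close>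

datatype 'k ralg = RAlg (coord: "bas \<Rightarrow> 'k")

lemma ralg_eqI: "(\<And>c. coord a c = coord b c) \<Longrightarrow> a = b"
  by (cases a; cases b) auto

instantiation ralg :: (field) ring_1
begin

definition zero_ralg :: "'a ralg" where
  "0 = RAlg (\<lambda>_. 0)"

definition one_ralg :: "'a ralg" where
  "1 = RAlg (\<lambda>c. if c = BE \<or> c = BF I1 I1 \<or> c = BF I2 I2 then 1 else 0)"

definition plus_ralg :: "'a ralg \<Rightarrow> 'a ralg \<Rightarrow> 'a ralg" where
  "a + b = RAlg (\<lambda>c. coord a c + coord b c)"

definition minus_ralg :: "'a ralg \<Rightarrow> 'a ralg \<Rightarrow> 'a ralg" where
  "a - b = RAlg (\<lambda>c. coord a c - coord b c)"

definition uminus_ralg :: "'a ralg \<Rightarrow> 'a ralg" where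
  "- a = RAlg (\<lambda>c. - coord a c)"

definition times_ralg :: "'a ralg \<Rightarrow> 'a ralg \<Rightarrow> 'a ralg" where
  "a * b = RAlg (\<lambda>c. \<Sum>p\<in>UNIV. \<Sum>q\<in>UNIV. if bprod p q = Some c then coord a p * coord b q else 0)"

lemma coord_times:
  fixes a b :: "'a ralg"
  shows "coord (a * b) BE = coord a BE * coord b BE"
    and "coord (a * b) (BX i) =
      coord a BE * coord b (BX i) + coord a (BX I1) * coord b (BF I1 i) + coord a (BX I2) * coord b (BF I2 i)"
    and "coord (a * b) (BY i) =
      coord a (BY i) * coord b BE + coord a (BF i I1) * coord b (BY I1) + coord a (BF i I2) * coord b (BY I2)"
    and "coord (a * b) (BF i j) =
      coord a (BF i I1) * coord b (BF I1 j) + coord a (BF i I2) * coord b (BF I2 j)"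
  subgoal by (simp add: times_ralg_def UNIV_bas)
  subgoal by (cases i) (simp_all add: times_ralg_def UNIV_bas)
  subgoal by (cases i) (simp_all add: times_ralg_def UNIV_bas)
  subgoal by (cases i; cases j) (simp_all add: times_ralg_def UNIV_bas)
  done

instance
proof
  fix a b c :: "'a ralg"
  show "a * b * c = a * (b * c)"
    by (rule ralg_eqI, rename_tac x, case_tac x) (simp_all add: coord_times algebra_simps)
  show "(a + b) * c = a * c + b * c"
    by (rule ralg_eqI, rename_tac x, case_tac x)
      (simp_all add: coord_times plus_ralg_def algebra_simps)
  show "a * (b + c) = a * b + a * c"
    by (rule ralg_eqI, rename_tac x, case_tac x)
      (simp_all add: coord_times plus_ralg_def algebra_simps)
  show "1 * a = a"
  proof (rule ralg_eqI)
    fix x show "coord (1 * a) x = coord a x"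
    proof (cases x)
      case BE
      then show ?thesis by (simp add: coord_times one_ralg_def)
    next
      case (BX i)
      then show ?thesis by (cases i) (simp_all add: coord_times one_ralg_def)
    next
      case (BY i)
      then show ?thesis by (cases i) (simp_all add: coord_times one_ralg_def)
    next
      case (BF i j)
      then show ?thesis by (cases i) (simp_all add: coord_times one_ralg_def)
    qed
  qed
  show "a * 1 = a"
  proof (rule ralg_eqI)
    fix x show "coord (a * 1) x = coord a x"
    proof (cases x)
      case BE
      then show ?thesis by (simp add: coord_times one_ralg_def)
    next
      case (BX i)
      then show ?thesis by (cases i) (simp_all add: coord_times one_ralg_def)
    next
      case (BY i)
      then show ?thesis by (cases i) (simp_all add: coord_times one_ralg_def)
    next
      case (BF i j)
      then show ?thesis by (cases j) (simp_all add: coord_times one_ralg_def)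
    qed
  qed
  have "coord (0 :: 'a ralg) BE \<noteq> coord 1 BE"
    by (simp add: zero_ralg_def one_ralg_def)
  then show "(0 :: 'a ralg) \<noteq> 1"
    by metis
qed (rule ralg_eqI; simp add: zero_ralg_def plus_ralg_def minus_ralg_def uminus_ralg_def)+

end

definition rscale :: "'k::field \<Rightarrow> 'k ralg \<Rightarrow> 'k ralg" where
  "rscale k a = RAlg (\<lambda>c. k * coord a c)"

definition basis_elem :: "bas \<Rightarrow> 'k::field ralg" where
  "basis_elem b = RAlg (\<lambda>c. if c = b then 1 else 0)"

lemma basis_elem_mult:
  "(basis_elem p * basis_elem q :: 'k::field ralg) =
     (case bprod p q of None \<Rightarrow> 0 | Some c \<Rightarrow> basis_elem c)"
proof (rule ralg_eqI)
  fix d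
  let ?z = "if bprod p q = Some d then 1 else 0 :: 'k"
  have eq: "(if bprod p' q' = Some d
           then coord (basis_elem p :: 'k ralg) p' * coord (basis_elem q) q' else 0)
        = (if p' = p then 1 else 0) * (if q' = q then ?z else 0)" for p' q'
    by (simp add: basis_elem_def)
  have "coord (basis_elem p * basis_elem q :: 'k ralg) d = ?z"
    unfolding times_ralg_def ralg.sel eq sum_distrib_left [symmetric] sum_distrib_right [symmetric]
    by simp
  then show "coord (basis_elem p * basis_elem q :: 'k ralg) d =
      coord (case bprod p q of None \<Rightarrow> 0 | Some c \<Rightarrow> basis_elem c) d"
    by (auto simp: zero_ralg_def basis_elem_def split: option.split)
qed

lemma k_algebra_rscale: "k_algebra rscale"
proof
  fix k l :: 'a and a b :: "'a ralg"
  show "rscale k (a + b) = rscale k a + rscale k b" "rscale (k + l) a = rscale k a + rscale l a"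
    "rscale k (rscale l a) = rscale (k * l) a" "rscale 1 a = a"
    by (auto intro!: ralg_eqI simp: rscale_def plus_ralg_def algebra_simps)
  show "rscale k a * b = rscale k (a * b)"
    by (rule ralg_eqI, rename_tac x, case_tac x) (simp_all add: coord_times rscale_def algebra_simps)
  show "a * rscale k b = rscale k (a * b)"
    by (rule ralg_eqI, rename_tac x, case_tac x) (simp_all add: coord_times rscale_def algebra_simps)
qed

end

theory Submission
  imports Defs
begin

text \<open>The algebra \<open>R\<close> and its dual \<open>R\<^sup>*\<close> are the even and the odd part of the
  \<open>\<int>/2\<close>-graded algebra \<open>A = M\<^sub>3(K[x]/(x\<^sup>2))\<close>, so multiplication in \<open>A\<close> gives
  \<open>R\<^sup>* \<otimes>\<^sub>R R\<^sup>* \<simeq> R\<close>. An invertible bimodule \<open>P\<close> is a left progenerator whose left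
  endomorphisms are the right multiplications. Hence \<open>P e'\<close>, for \<open>e' \<in> {E, F\<^sub>1\<^sub>1}\<close>, is isomorphic
  to \<open>R e\<close> with \<open>e \<in> {E, F\<^sub>1\<^sub>1}\<close>, and both \<open>e\<close> occur because \<open>P\<close> is a generator. The two possible
  matchings make \<open>P\<close> isomorphic to \<open>R\<close> or to \<open>R\<^sup>*\<close> as a left module, and the right action is then
  the standard one twisted by an automorphism. The twist of \<open>R\<close> by \<open>\<alpha>\<close> is trivial exactly for
  inner \<open>\<alpha>\<close>, and a twist of \<open>R\<^sup>*\<close> is never isomorphic to \<open>R\<close>: every \<open>d \<in> R\<^sup>*\<close> is annihilated by a nonzero
  combination of \<open>X\<^sub>1, X\<^sub>2\<close>.\<close>

section \<open>Finite sums and bimodules\<close>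

text \<open>In R all products X_i Y_j and Y_i X_j vanish because the off-diagonal entries of the
  even part carry x; in the odd part the diagonal entries carry it instead. The coefficient of x in
  the trace pairs the two parts perfectly, which is how the odd part becomes the dual. Storing both
  parts on the type \<open>'k ralg\<close> lets one Boolean degree index the single family
  \<open>gbimod s \<alpha>\<close>, with product law (s, \<alpha>)(t, \<beta>) = (s + t, \<alpha>
  \<beta>). An automorphism acts on the dual by transposition, so a twist can be moved past the
  dual: hence a direct product and not a semidirect one. The same law makes Pic an image of Aut x
  C_2, from which it inherits the group axioms; associativity of the tensor product is never proved.
  Two obstacles shape the rest. The isomorphisms of P \<otimes> Q and Q \<otimes> P with R are
  unrelated, so no Morita context is given. And the elements of Pic are classes of bimodules carried
  by subsets of one fixed type, so the graded pieces enter only through copies.\<close>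

definition gsum :: "('m, 'z) monoid_scheme \<Rightarrow> ('a \<Rightarrow> 'm) \<Rightarrow> 'a list \<Rightarrow> 'm" where
  "gsum G f xs = foldr (\<lambda>x y. f x \<otimes>\<^bsub>G\<^esub> y) xs \<one>\<^bsub>G\<^esub>"

lemma gsum_Nil [simp]: "gsum G f [] = \<one>\<^bsub>G\<^esub>"
  and gsum_Cons [simp]: "gsum G f (x # xs) = f x \<otimes>\<^bsub>G\<^esub> gsum G f xs"
  by (simp_all add: gsum_def)

lemma gsum_map: "gsum G f (map g xs) = gsum G (f \<circ> g) xs"
  by (induction xs) auto

lemma gsum_cong: "(\<And>x. x \<in> set xs \<Longrightarrow> f x = g x) \<Longrightarrow> gsum G f xs = gsum G g xs"
  by (induction xs) auto

lemma (in monoid) gsum_closed: "(\<And>x. x \<in> set xs \<Longrightarrow> f x \<in> carrier G) \<Longrightarrow> gsum G f xs \<in> carrier G"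
  by (induction xs) auto

lemma (in monoid) gsum_append:
  assumes "\<And>x. x \<in> set xs \<union> set ys \<Longrightarrow> f x \<in> carrier G"
  shows "gsum G f (xs @ ys) = gsum G f xs \<otimes> gsum G f ys"
  using assms by (induction xs) (auto simp: m_assoc gsum_closed)

lemma (in monoid) gsum_one: "(\<And>x. x \<in> set xs \<Longrightarrow> f x = \<one>) \<Longrightarrow> gsum G f xs = \<one>"
  by (induction xs) auto

lemma hom_gsum:
  assumes "group G" "group H" "h \<in> hom G H" "\<And>x. x \<in> set xs \<Longrightarrow> f x \<in> carrier G"
  shows "h (gsum G f xs) = gsum H (\<lambda>x. h (f x)) xs"
  using assms(4)
  by (induction xs)
    (auto simp: hom_one [OF assms(3,1,2)] hom_mult [OF assms(3)] monoid.gsum_closed group.is_monoid assms(1))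

lemma (in comm_group) gsum_mult_inv:
  assumes "\<And>x. x \<in> set xs \<Longrightarrow> f x \<in> carrier G"
  shows "gsum G (\<lambda>x. inv (f x)) xs = inv (gsum G f xs)"
  using assms by (induction xs) (auto simp: gsum_closed inv_mult)

lemma regular_bimod_simps [simp]:
  "carrier regular_bimod = UNIV" "monoid.mult regular_bimod = (+)" "one regular_bimod = 0"
  "lact regular_bimod = (*)" "ract regular_bimod = (*)"
  by (simp_all add: regular_bimod_def)

lemma gsum_regular: "gsum regular_bimod f xs = (\<Sum>x\<leftarrow>xs. f x)"
  by (induction xs) auto

lemma comm_group_regular: "comm_group regular_bimod"
  by (rule comm_groupI) (auto simp: algebra_simps, metis add.right_inverse)

context bimodule
begin

lemma lact_hom: "lact M r \<in> hom M M"
  by (rule homI) (auto simp: lact_closed lact_add)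

lemma ract_hom: "(\<lambda>m. ract M m r) \<in> hom M M"
  by (rule homI) (auto simp: ract_closed ract_add)

lemma lact_hom_left: "m \<in> carrier M \<Longrightarrow> (\<lambda>r. lact M r m) \<in> hom regular_bimod M"
  by (rule homI) (auto simp: lact_closed add_lact)

lemma ract_hom_right: "m \<in> carrier M \<Longrightarrow> (\<lambda>r. ract M m r) \<in> hom regular_bimod M"
  by (rule homI) (auto simp: ract_closed add_ract)

lemma group_regular: "group regular_bimod"
  using comm_group_regular comm_group_def by blast

lemma lact_zero [simp]: "lact M r \<one> = \<one>"
  using hom_one [OF lact_hom is_group is_group] .

lemma ract_zero [simp]: "ract M \<one> r = \<one>"
  using hom_one [OF ract_hom is_group is_group] .

lemma zero_lact [simp]: "m \<in> carrier M \<Longrightarrow> lact M 0 m = \<one>"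
  using hom_one [OF lact_hom_left group_regular is_group] by simp

lemma zero_ract [simp]: "m \<in> carrier M \<Longrightarrow> ract M m 0 = \<one>"
  using hom_one [OF ract_hom_right group_regular is_group] by simp

end

text \<open>Only a group with closed actions is assumed, because this is also applied to tensor
  products, whose bimodule axioms are never established.\<close>

lemma bimod_iso_sym:
  assumes "group M" and "\<And>r m. m \<in> carrier M \<Longrightarrow> lact M r m \<in> carrier M"
    and "\<And>r m. m \<in> carrier M \<Longrightarrow> ract M m r \<in> carrier M" and "M \<simeq>\<^sub>b N"
  shows "N \<simeq>\<^sub>b M"
proof -
  from assms(4) obtain f where f: "f \<in> iso M N"
    and l: "\<And>m r. m \<in> carrier M \<Longrightarrow> f (lact M r m) = lact N r (f m)"
    and r: "\<And>m r. m \<in> carrier M \<Longrightarrow> f (ract M m r) = ract N (f m) r"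
    unfolding bimod_iso_def by blast
  let ?g = "inv_into (carrier M) f"
  have g: "?g \<in> iso N M"
    by (rule group.iso_set_sym [OF assms(1) f])
  have inj: "inj_on f (carrier M)" and im: "f ` carrier M = carrier N"
    using f by (auto simp: iso_def bij_betw_def)
  have "?g (lact N r n) = lact M r (?g n) \<and> ?g (ract N n r) = ract M (?g n) r"
    if n: "n \<in> carrier N" for n r
  proof -
    obtain m where "m \<in> carrier M" "n = f m"
      using n im by blast
    then show ?thesis
      using l [of m r] r [of m r] assms(2,3) inj
      by (metis inv_into_f_f)
  qed
  with g show ?thesis
    unfolding bimod_iso_def by blast
qed

lemma bimod_iso_trans:
  assumes "M \<simeq>\<^sub>b N" "N \<simeq>\<^sub>b L"
  shows "M \<simeq>\<^sub>b L"
proof -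
  from assms obtain f g where f: "f \<in> iso M N" and g: "g \<in> iso N L"
    and "\<forall>m \<in> carrier M. \<forall>r. f (lact M r m) = lact N r (f m) \<and> f (ract M m r) = ract N (f m) r"
    and "\<forall>m \<in> carrier N. \<forall>r. g (lact N r m) = lact L r (g m) \<and> g (ract N m r) = ract L (g m) r"
    unfolding bimod_iso_def by blast
  moreover have "f m \<in> carrier N" if "m \<in> carrier M" for m
    using f that by (auto simp: iso_def hom_def)
  ultimately have "g \<circ> f \<in> iso M L"
      "\<forall>m \<in> carrier M. \<forall>r. (g \<circ> f) (lact M r m) = lact L r ((g \<circ> f) m) \<and>
         (g \<circ> f) (ract M m r) = ract L ((g \<circ> f) m) r"
    by (auto intro: iso_set_trans)
  then show ?thesis
    unfolding bimod_iso_def by blast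
qed

lemma (in bimodule) bimod_iso_symI: "M \<simeq>\<^sub>b N \<Longrightarrow> N \<simeq>\<^sub>b M"
  by (rule bimod_iso_sym [OF is_group]) (auto simp: lact_closed ract_closed)

section \<open>The tensor product\<close>

definition tens :: "('r, 'p) bimod \<Rightarrow> ('r, 'q) bimod \<Rightarrow> 'p \<Rightarrow> 'q \<Rightarrow> ('p \<times> 'q \<Rightarrow>\<^sub>0 int) set" where
  "tens P Q p q = tensor_null P Q #>\<^bsub>tensor_free P Q\<^esub> frag_of (p, q)"

lemma tensor_bimod_group_simps [simp]:
  "carrier (tensor_bimod P Q) = carrier (tensor_free P Q Mod tensor_null P Q)"
  "monoid.mult (tensor_bimod P Q) = monoid.mult (tensor_free P Q Mod tensor_null P Q)"
  "one (tensor_bimod P Q) = one (tensor_free P Q Mod tensor_null P Q)"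
  by (simp_all add: tensor_bimod_def Let_def)

definition biadditive ::
    "('r, 'p) bimod \<Rightarrow> ('r, 'q) bimod \<Rightarrow> ('t, 'z) monoid_scheme \<Rightarrow> ('p \<Rightarrow> 'q \<Rightarrow> 't) \<Rightarrow> bool" where
  "biadditive P Q T b \<longleftrightarrow>
     (\<forall>p \<in> carrier P. b p \<in> hom Q T) \<and> (\<forall>q \<in> carrier Q. (\<lambda>p. b p q) \<in> hom P T)"

definition balanced :: "('r, 'p) bimod \<Rightarrow> ('r, 'q) bimod \<Rightarrow> ('p \<Rightarrow> 'q \<Rightarrow> 't) \<Rightarrow> bool" where
  "balanced P Q b \<longleftrightarrow> (\<forall>p \<in> carrier P. \<forall>q \<in> carrier Q. \<forall>r. b (ract P p r) q = b p (lact Q r q))"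

locale bimodule_pair = P: bimodule scale P + Q: bimodule scale Q
  for scale :: "'k::field \<Rightarrow> 'r::ring_1 \<Rightarrow> 'r" and P :: "('r, 'p) bimod" and Q :: "('r, 'q) bimod"
begin

abbreviation "F \<equiv> tensor_free P Q"
abbreviation "H \<equiv> tensor_null P Q"
abbreviation "T \<equiv> tensor_bimod P Q"

sublocale F: comm_group F
  unfolding tensor_free_def by (rule abelian_free_Abelian_group)

lemma tensor_free_simps [simp]:
  "x \<in> carrier F \<longleftrightarrow> Poly_Mapping.keys x \<subseteq> carrier P \<times> carrier Q"
  "x \<otimes>\<^bsub>F\<^esub> y = x + y" "\<one>\<^bsub>F\<^esub> = 0"
  by (simp_all add: tensor_free_def)

lemma keys_add_subset: "Poly_Mapping.keys x \<subseteq> A \<Longrightarrow> Poly_Mapping.keys y \<subseteq> A \<Longrightarrow> Poly_Mapping.keys (x + y) \<subseteq> A"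
  using keys_add [of x y] by blast

lemma keys_diff_subset: "Poly_Mapping.keys x \<subseteq> A \<Longrightarrow> Poly_Mapping.keys y \<subseteq> A \<Longrightarrow> Poly_Mapping.keys (x - y) \<subseteq> A"
  using keys_diff [of x y] by blast

lemma tensor_rels_cases:
  assumes "x \<in> tensor_rels P Q"
  obtains p p' q where "p \<in> carrier P" "p' \<in> carrier P" "q \<in> carrier Q"
      "x = frag_of (p \<otimes>\<^bsub>P\<^esub> p', q) - (frag_of (p, q) + frag_of (p', q))"
    | p q q' where "p \<in> carrier P" "q \<in> carrier Q" "q' \<in> carrier Q"
      "x = frag_of (p, q \<otimes>\<^bsub>Q\<^esub> q') - (frag_of (p, q) + frag_of (p, q'))"
    | p r q where "p \<in> carrier P" "q \<in> carrier Q"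
      "x = frag_of (ract P p r, q) - frag_of (p, lact Q r q)"
  using assms unfolding tensor_rels_def Un_iff mem_Collect_eq
  by (elim disjE exE conjE) ((rule that(1); assumption), (rule that(2); assumption), (rule that(3); assumption))

lemma tensor_rels_carrier: "tensor_rels P Q \<subseteq> carrier F"
proof
  fix x
  assume "x \<in> tensor_rels P Q"
  then show "x \<in> carrier F"
    by (cases rule: tensor_rels_cases)
      (simp_all add: P.ract_closed Q.lact_closed keys_diff_subset keys_add_subset)
qed

lemma subgroup_null: "subgroup H F"
  unfolding tensor_null_def by (rule F.generate_is_subgroup [OF tensor_rels_carrier])

sublocale H: normal H F
  using subgroup_null F.normal_iff_subgroup by simp

lemma comm_group_Mod: "comm_group (F Mod H)"
  by (rule F.abelian_FactGroup [OF subgroup_null])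

sublocale T: comm_group T
proof -
  interpret M: comm_group "F Mod H" by (rule comm_group_Mod)
  show "comm_group T"
    by (rule comm_groupI) (auto simp del: mult_FactGroup one_FactGroup simp: M.m_ac intro: M.l_inv_ex)
qed

lemma coset_hom: "(\<lambda>x. H #>\<^bsub>F\<^esub> x) \<in> hom F T"
  using H.r_coset_hom_Mod by (simp add: hom_def)

lemma coset_eqI: "x \<in> carrier F \<Longrightarrow> y \<in> carrier F \<Longrightarrow> x - y \<in> H \<Longrightarrow> H #>\<^bsub>F\<^esub> x = H #>\<^bsub>F\<^esub> y"
proof -
  assume x: "x \<in> carrier F" and y: "y \<in> carrier F" and "x - y \<in> H"
  then have "x \<in> H #>\<^bsub>F\<^esub> y"
    unfolding r_coset_def by (auto intro!: bexI [of _ "x - y"])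
  then show ?thesis
    using F.repr_independence [OF _ y subgroup_null] by blast
qed

lemma rels_null: "x \<in> tensor_rels P Q \<Longrightarrow> x \<in> H"
  unfolding tensor_null_def by (rule generate.incl)

lemma null_add_left:
  assumes "p \<in> carrier P" "p' \<in> carrier P" "q \<in> carrier Q"
  shows "frag_of (p \<otimes>\<^bsub>P\<^esub> p', q) - (frag_of (p, q) + frag_of (p', q)) \<in> H"
  using assms by (intro rels_null) (auto simp: tensor_rels_def)

lemma null_add_right:
  assumes "p \<in> carrier P" "q \<in> carrier Q" "q' \<in> carrier Q"
  shows "frag_of (p, q \<otimes>\<^bsub>Q\<^esub> q') - (frag_of (p, q) + frag_of (p, q')) \<in> H"
proof (rule rels_null)
  show "frag_of (p, q \<otimes>\<^bsub>Q\<^esub> q') - (frag_of (p, q) + frag_of (p, q')) \<in> tensor_rels P Q"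
    unfolding tensor_rels_def using assms by blast
qed

lemma null_balanced:
  assumes "p \<in> carrier P" "q \<in> carrier Q"
  shows "frag_of (ract P p r, q) - frag_of (p, lact Q r q) \<in> H"
  using assms by (intro rels_null) (auto simp: tensor_rels_def)

lemma tens_closed: "p \<in> carrier P \<Longrightarrow> q \<in> carrier Q \<Longrightarrow> tens P Q p q \<in> carrier T"
  unfolding tens_def by (rule hom_in_carrier [OF coset_hom]) simp

lemma tens_biadditive: "biadditive P Q T (tens P Q)"
  unfolding biadditive_def
proof (intro conjI ballI)
  fix p assume p: "p \<in> carrier P"
  show "tens P Q p \<in> hom Q T"
  proof (rule homI)
    fix q q' assume q: "q \<in> carrier Q" "q' \<in> carrier Q"
    have "tens P Q p (q \<otimes>\<^bsub>Q\<^esub> q') = H #>\<^bsub>F\<^esub> (frag_of (p, q) + frag_of (p, q'))"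
      unfolding tens_def
      by (rule coset_eqI) (use p q in \<open>simp_all add: null_add_right keys_add_subset\<close>)
    also have "\<dots> = tens P Q p q \<otimes>\<^bsub>T\<^esub> tens P Q p q'"
      using hom_mult [OF coset_hom, of "frag_of (p, q)" "frag_of (p, q')"] p q by (simp add: tens_def)
    finally show "tens P Q p (q \<otimes>\<^bsub>Q\<^esub> q') = tens P Q p q \<otimes>\<^bsub>T\<^esub> tens P Q p q'" .
  qed (use p tens_closed in auto)
next
  fix q assume q: "q \<in> carrier Q"
  show "(\<lambda>p. tens P Q p q) \<in> hom P T"
  proof (rule homI)
    fix p p' assume p: "p \<in> carrier P" "p' \<in> carrier P"
    have "tens P Q (p \<otimes>\<^bsub>P\<^esub> p') q = H #>\<^bsub>F\<^esub> (frag_of (p, q) + frag_of (p', q))"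
      unfolding tens_def
      by (rule coset_eqI) (use p q in \<open>simp_all add: null_add_left keys_add_subset\<close>)
    also have "\<dots> = tens P Q p q \<otimes>\<^bsub>T\<^esub> tens P Q p' q"
      using hom_mult [OF coset_hom, of "frag_of (p, q)" "frag_of (p', q)"] p q by (simp add: tens_def)
    finally show "tens P Q (p \<otimes>\<^bsub>P\<^esub> p') q = tens P Q p q \<otimes>\<^bsub>T\<^esub> tens P Q p' q" .
  qed (use q tens_closed in auto)
qed

lemma tens_balanced: "balanced P Q (tens P Q)"
  unfolding balanced_def tens_def
  by (intro ballI allI coset_eqI) (simp_all add: null_balanced P.ract_closed Q.lact_closed)

text \<open>Signs are absorbed in the first factor, -(p \<otimes> q) = (-p) \<otimes> q, so lists of
  pure tensors are closed under differences and no integer coefficients occur.\<close>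

lemma tensor_list:
  assumes "t \<in> carrier T"
  obtains xs where "set xs \<subseteq> carrier P \<times> carrier Q" "t = gsum T (\<lambda>(p, q). tens P Q p q) xs"
proof -
  from assms obtain x where x: "Poly_Mapping.keys x \<subseteq> carrier P \<times> carrier Q" and t: "t = H #>\<^bsub>F\<^esub> x"
    by (auto simp: carrier_FactGroup)
  have "\<exists>xs. set xs \<subseteq> carrier P \<times> carrier Q \<and> H #>\<^bsub>F\<^esub> x = gsum T (\<lambda>(p, q). tens P Q p q) xs"
    using x
  proof (induction x rule: free_Abelian_group_induct [consumes 1, case_names 1 2 3])
    case 1
    then show ?case
      using hom_one [OF coset_hom F.is_group T.is_group] by (intro exI [of _ "[]"]) simp
  next
    case (2 x y)
    then obtain xs ys where xs: "set xs \<subseteq> carrier P \<times> carrier Q" "H #>\<^bsub>F\<^esub> x = gsum T (\<lambda>(p, q). tens P Q p q) xs"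
      and ys: "set ys \<subseteq> carrier P \<times> carrier Q" "H #>\<^bsub>F\<^esub> y = gsum T (\<lambda>(p, q). tens P Q p q) ys"
      by blast
    let ?n = "\<lambda>(p, q). (inv\<^bsub>P\<^esub> p, q)"
    have neg: "tens P Q (inv\<^bsub>P\<^esub> p) q = inv\<^bsub>T\<^esub> tens P Q p q" if "p \<in> carrier P" "q \<in> carrier Q" for p q
      using group_hom.hom_inv [of P T "\<lambda>p. tens P Q p q" p] that tens_biadditive
      by (simp add: group_hom_def group_hom_axioms_def biadditive_def)
    have "H #>\<^bsub>F\<^esub> (x - y) = H #>\<^bsub>F\<^esub> (x \<otimes>\<^bsub>F\<^esub> inv\<^bsub>F\<^esub> y)"
      using 2 by (simp add: tensor_free_def)
    also have "\<dots> = (H #>\<^bsub>F\<^esub> x) \<otimes>\<^bsub>T\<^esub> inv\<^bsub>T\<^esub> (H #>\<^bsub>F\<^esub> y)"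
      using 2 group_hom.hom_inv [of F T "\<lambda>x. H #>\<^bsub>F\<^esub> x" y] coset_hom F.inv_closed [of y]
      by (subst hom_mult [OF coset_hom]) (simp_all add: group_hom_def group_hom_axioms_def)
    also have "inv\<^bsub>T\<^esub> (H #>\<^bsub>F\<^esub> y) = gsum T (\<lambda>(p, q). tens P Q p q) (map ?n ys)"
      unfolding gsum_map ys(2)
      by (subst T.gsum_mult_inv [symmetric])
        (use ys(1) tens_closed in \<open>auto intro!: gsum_cong simp: neg\<close>)
    also have "(H #>\<^bsub>F\<^esub> x) \<otimes>\<^bsub>T\<^esub> gsum T (\<lambda>(p, q). tens P Q p q) (map ?n ys) =
        gsum T (\<lambda>(p, q). tens P Q p q) (xs @ map ?n ys)"
      unfolding xs(2)
      by (subst T.gsum_append) (use xs(1) ys(1) tens_closed in \<open>auto split: prod.splits\<close>)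
    finally show ?case
      using xs(1) ys(1) by (intro exI [of _ "xs @ map ?n ys"] conjI) auto
  next
    case (3 a)
    then show ?case
      using tens_closed [of "fst a" "snd a"]
      by (intro exI [of _ "[a]"]) (auto simp: tens_def simp del: tensor_bimod_group_simps split: prod.splits)
  qed
  then show ?thesis
    using that t by blast
qed

lemma tensor_hom_eq:
  assumes "group G" "f \<in> hom T G" "g \<in> hom T G"
    and "\<And>p q. p \<in> carrier P \<Longrightarrow> q \<in> carrier Q \<Longrightarrow> f (tens P Q p q) = g (tens P Q p q)"
    and t: "t \<in> carrier T"
  shows "f t = g t"
proof -
  obtain xs where xs: "set xs \<subseteq> carrier P \<times> carrier Q" and t: "t = gsum T (\<lambda>(p, q). tens P Q p q) xs"
    using tensor_list [OF t] .
  have c: "(case x of (p, q) \<Rightarrow> tens P Q p q) \<in> carrier T" if "x \<in> set xs" for x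
    using that xs tens_closed by auto
  have "f t = gsum G (\<lambda>x. f (case x of (p, q) \<Rightarrow> tens P Q p q)) xs"
    unfolding t by (rule hom_gsum [OF T.is_group assms(1,2) c])
  also have "\<dots> = gsum G (\<lambda>x. g (case x of (p, q) \<Rightarrow> tens P Q p q)) xs"
    by (rule gsum_cong) (use xs assms(4) in auto)
  also have "\<dots> = g t"
    unfolding t by (rule hom_gsum [OF T.is_group assms(1,3) c, symmetric])
  finally show ?thesis .
qed

text \<open>Additivity of \<open>b\<close> kills the first two kinds of relation and balancedness
  the third, so the extension of \<open>b\<close> to the free group factors through the
  quotient.\<close>

lemma tensor_universal:
  assumes G: "comm_group G" and b: "biadditive P Q G b" and bal: "balanced P Q b"
  obtains f where "f \<in> hom T G" "\<And>p q. p \<in> carrier P \<Longrightarrow> q \<in> carrier Q \<Longrightarrow> f (tens P Q p q) = b p q"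
proof -
  interpret G: comm_group G by (rule G)
  have bc: "b p q \<in> carrier G" if "p \<in> carrier P" "q \<in> carrier Q" for p q
    using b that by (auto simp: biadditive_def intro: hom_in_carrier)
  have "(\<lambda>(p, q). b p q) ` (carrier P \<times> carrier Q) \<subseteq> carrier G"
    using bc by auto
  then obtain h where h: "h \<in> hom F G"
    and hb: "\<And>x. x \<in> carrier P \<times> carrier Q \<Longrightarrow> h (frag_of x) = (\<lambda>(p, q). b p q) x"
    unfolding tensor_free_def using G.free_Abelian_group_universal by metis
  interpret h: group_hom F G h
    using h by unfold_locales
  have hdiff: "h (x - y) = h x \<otimes>\<^bsub>G\<^esub> inv\<^bsub>G\<^esub> h y" if "x \<in> carrier F" "y \<in> carrier F" for x y
  proof -
    have "x - y = x \<otimes>\<^bsub>F\<^esub> inv\<^bsub>F\<^esub> y"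
      using that by (simp add: tensor_free_def)
    then show ?thesis
      using that by (simp only: h.hom_mult h.hom_inv F.inv_closed)
  qed
  have hadd: "h (x + y) = h x \<otimes>\<^bsub>G\<^esub> h y" if "x \<in> carrier F" "y \<in> carrier F" for x y
    using h.hom_mult [OF that] by simp
  have hf: "h (frag_of (p, q)) = b p q" if "p \<in> carrier P" "q \<in> carrier Q" for p q
    using hb [of "(p, q)"] that by simp
  have "tensor_rels P Q \<subseteq> kernel F G h"
  proof
    fix x
    assume x: "x \<in> tensor_rels P Q"
    then have xc: "x \<in> carrier F"
      using tensor_rels_carrier by blast
    from x have "h x = \<one>\<^bsub>G\<^esub>"
    proof (cases rule: tensor_rels_cases)
      case (1 p p' q)
      have "b (p \<otimes>\<^bsub>P\<^esub> p') q = b p q \<otimes>\<^bsub>G\<^esub> b p' q"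
        using b 1 hom_mult [of "\<lambda>p. b p q" P G p p'] by (simp add: biadditive_def)
      then show ?thesis
        unfolding 1(4) using 1(1-3) bc by (subst hdiff) (simp_all add: hadd hf keys_add_subset G.r_inv)
    next
      case (2 p q q')
      have "b p (q \<otimes>\<^bsub>Q\<^esub> q') = b p q \<otimes>\<^bsub>G\<^esub> b p q'"
        using b 2 hom_mult [of "b p" Q G q q'] by (simp add: biadditive_def)
      then show ?thesis
        unfolding 2(4) using 2(1-3) bc by (subst hdiff) (simp_all add: hadd hf keys_add_subset G.r_inv)
    next
      case (3 p r q)
      then have "b (ract P p r) q = b p (lact Q r q)"
        using bal by (simp add: balanced_def)
      then show ?thesis
        unfolding 3(3) using 3(1,2) bc P.ract_closed Q.lact_closed by (subst hdiff) (simp_all add: hf G.r_inv)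
    qed
    with xc show "x \<in> kernel F G h"
      by (simp add: kernel_def)
  qed
  then have "H \<subseteq> kernel F G h"
    unfolding tensor_null_def by (rule F.generate_subgroup_incl [OF _ h.subgroup_kernel])
  then obtain g where g: "g \<in> hom (F Mod H) G" "\<And>x. x \<in> carrier F \<Longrightarrow> g (H #>\<^bsub>F\<^esub> x) = h x"
    using h.FactGroup_universal_kernel [OF H.normal_axioms] by blast
  show ?thesis
  proof
    show "g \<in> hom T G"
      using g(1) by (simp add: hom_def)
    show "g (tens P Q p q) = b p q" if "p \<in> carrier P" "q \<in> carrier Q" for p q
      using g(2) [of "frag_of (p, q)"] that by (simp add: tens_def hf)
  qed
qed

section \<open>The two actions on the tensor product\<close>

lemma frag_extend_null:
  assumes e: "\<And>x. x \<in> tensor_rels P Q \<Longrightarrow> frag_extend e x \<in> H" and x: "x \<in> H"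
  shows "frag_extend e x \<in> H"
proof -
  have xg: "x \<in> generate F (tensor_rels P Q)"
    using x by (simp add: tensor_null_def)
  have "x \<in> carrier F \<and> frag_extend e x \<in> H"
    using xg
  proof (induction rule: generate.induct)
    case one
    then show ?case
      using H.one_closed by simp
  next
    case (incl h)
    then show ?case
      using e tensor_rels_carrier by blast
  next
    case (inv h)
    then have h: "h \<in> carrier F" "frag_extend e h \<in> H"
      using e tensor_rels_carrier by blast+
    then have "inv\<^bsub>F\<^esub> h = - h" "inv\<^bsub>F\<^esub> (frag_extend e h) = - frag_extend e h"
      using H.mem_carrier [OF h(2)] by (simp_all add: tensor_free_def)
    then show ?case
      using h H.m_inv_closed [OF h(2)] F.inv_closed [OF h(1)] by (simp add: frag_extend_minus)
  next
    case (eng h1 h2)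
    then show ?case
      using H.m_closed by (simp add: frag_extend_add keys_add_subset)
  qed
  then show ?thesis ..
qed

lemma frag_extend_carrier:
  assumes "\<And>z. z \<in> carrier P \<times> carrier Q \<Longrightarrow> e z \<in> carrier F" and "x \<in> carrier F"
  shows "frag_extend e x \<in> carrier F"
  using keys_frag_extend [of e x] assms by (auto dest!: subsetD)

text \<open>The actions of \<open>tensor_bimod\<close> are unions over all representatives of a
  class. Since the extension of \<open>e\<close> maps \<open>H\<close> into itself, all members of
  such a union coincide and one representative suffices.\<close>

lemma union_coset:
  assumes e: "\<And>z. z \<in> carrier P \<times> carrier Q \<Longrightarrow> e z \<in> carrier F"
    and er: "\<And>x. x \<in> tensor_rels P Q \<Longrightarrow> frag_extend e x \<in> H" and x: "x \<in> carrier F"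
  shows "(\<Union>y \<in> H #>\<^bsub>F\<^esub> x. H #>\<^bsub>F\<^esub> frag_extend e y) = H #>\<^bsub>F\<^esub> frag_extend e x"
proof -
  have "H #>\<^bsub>F\<^esub> frag_extend e y = H #>\<^bsub>F\<^esub> frag_extend e x" if y: "y \<in> H #>\<^bsub>F\<^esub> x" for y
  proof -
    obtain h where h: "h \<in> H" "y = h + x"
      using y by (auto simp: r_coset_def)
    have hc: "h \<in> carrier F"
      using h H.mem_carrier by blast
    show ?thesis
      by (rule coset_eqI) (use x h hc frag_extend_carrier [OF e] frag_extend_null [OF er] in
          \<open>simp_all add: frag_extend_add keys_add_subset\<close>)
  qed
  moreover have "x \<in> H #>\<^bsub>F\<^esub> x"
    using F.rcos_self [OF x subgroup_null] .
  ultimately show ?thesis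
    by blast
qed

lemma tensor_lact_coset:
  assumes "x \<in> carrier F"
  shows "lact T r (H #>\<^bsub>F\<^esub> x) = H #>\<^bsub>F\<^esub> frag_extend (\<lambda>(p, q). frag_of (lact P r p, q)) x"
proof -
  have "lact T r (H #>\<^bsub>F\<^esub> x) = (\<Union>y \<in> H #>\<^bsub>F\<^esub> x. H #>\<^bsub>F\<^esub> frag_extend (\<lambda>(p, q). frag_of (lact P r p, q)) y)"
    by (simp add: tensor_bimod_def Let_def)
  also have "\<dots> = H #>\<^bsub>F\<^esub> frag_extend (\<lambda>(p, q). frag_of (lact P r p, q)) x"
  proof (rule union_coset [OF _ _ assms])
    fix x
    assume "x \<in> tensor_rels P Q"
    then show "frag_extend (\<lambda>(p, q). frag_of (lact P r p, q)) x \<in> H"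
      by (cases rule: tensor_rels_cases)
        (simp_all add: frag_extend_diff frag_extend_add P.lact_add P.lact_ract [symmetric] P.lact_closed
          null_add_left null_add_right null_balanced)
  qed (auto simp: P.lact_closed)
  finally show ?thesis .
qed

lemma tensor_ract_coset:
  assumes "x \<in> carrier F"
  shows "ract T (H #>\<^bsub>F\<^esub> x) r = H #>\<^bsub>F\<^esub> frag_extend (\<lambda>(p, q). frag_of (p, ract Q q r)) x"
proof -
  have "ract T (H #>\<^bsub>F\<^esub> x) r = (\<Union>y \<in> H #>\<^bsub>F\<^esub> x. H #>\<^bsub>F\<^esub> frag_extend (\<lambda>(p, q). frag_of (p, ract Q q r)) y)"
    by (simp add: tensor_bimod_def Let_def)
  also have "\<dots> = H #>\<^bsub>F\<^esub> frag_extend (\<lambda>(p, q). frag_of (p, ract Q q r)) x"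
  proof (rule union_coset [OF _ _ assms])
    fix x
    assume "x \<in> tensor_rels P Q"
    then show "frag_extend (\<lambda>(p, q). frag_of (p, ract Q q r)) x \<in> H"
      by (cases rule: tensor_rels_cases)
        (simp_all add: frag_extend_diff frag_extend_add Q.ract_add Q.lact_ract Q.ract_closed
          null_add_left null_add_right null_balanced)
  qed (auto simp: Q.ract_closed)
  finally show ?thesis .
qed

lemma coset_frag_extend_hom:
  assumes e: "\<And>z. z \<in> carrier P \<times> carrier Q \<Longrightarrow> e z \<in> carrier F"
    and f: "\<And>x. x \<in> carrier F \<Longrightarrow> f (H #>\<^bsub>F\<^esub> x) = H #>\<^bsub>F\<^esub> frag_extend e x"
  shows "f \<in> hom T T"
proof (rule homI)
  fix s assume "s \<in> carrier T"
  then obtain x where x: "x \<in> carrier F" "s = H #>\<^bsub>F\<^esub> x"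
    by (auto simp: carrier_FactGroup)
  then show "f s \<in> carrier T"
    using f [OF x(1)] hom_in_carrier [OF coset_hom frag_extend_carrier [OF e x(1)]] by simp
  fix t assume "t \<in> carrier T"
  then obtain y where y: "y \<in> carrier F" "t = H #>\<^bsub>F\<^esub> y"
    by (auto simp: carrier_FactGroup)
  show "f (s \<otimes>\<^bsub>T\<^esub> t) = f s \<otimes>\<^bsub>T\<^esub> f t"
    using f [OF x(1)] f [OF y(1)] f [OF F.m_closed [OF x(1) y(1)]] x y
      hom_mult [OF coset_hom x(1) y(1)]
      hom_mult [OF coset_hom frag_extend_carrier [OF e x(1)] frag_extend_carrier [OF e y(1)]]
    by (simp add: frag_extend_add)
qed

lemma tensor_lact_hom: "lact T r \<in> hom T T"
  by (rule coset_frag_extend_hom [where e = "\<lambda>(p, q). frag_of (lact P r p, q)"])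
    (use tensor_lact_coset P.lact_closed in auto)

lemma tensor_ract_hom: "(\<lambda>t. ract T t r) \<in> hom T T"
  by (rule coset_frag_extend_hom [where e = "\<lambda>(p, q). frag_of (p, ract Q q r)"])
    (use tensor_ract_coset Q.ract_closed in auto)

lemma lact_tens: "p \<in> carrier P \<Longrightarrow> q \<in> carrier Q \<Longrightarrow> lact T r (tens P Q p q) = tens P Q (lact P r p) q"
  unfolding tens_def by (subst tensor_lact_coset) auto

lemma ract_tens: "p \<in> carrier P \<Longrightarrow> q \<in> carrier Q \<Longrightarrow> ract T (tens P Q p q) r = tens P Q p (ract Q q r)"
  unfolding tens_def by (subst tensor_ract_coset) auto

end

declare tensor_bimod_group_simps [simp del]

lemma bimodule_pairI: "bimodule scale P \<Longrightarrow> bimodule scale Q \<Longrightarrow> bimodule_pair scale P Q"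
  by (simp add: bimodule_pair_def)

lemma (in comm_group) gsum_mult:
  assumes "\<And>x. x \<in> set xs \<Longrightarrow> f x \<in> carrier G" "\<And>x. x \<in> set xs \<Longrightarrow> g x \<in> carrier G"
  shows "gsum G (\<lambda>x. f x \<otimes> g x) xs = gsum G f xs \<otimes> gsum G g xs"
  using assms
proof (induction xs)
  case (Cons a xs)
  have "gsum G f xs \<in> carrier G" "gsum G g xs \<in> carrier G"
    using Cons.prems by (auto intro: gsum_closed)
  then show ?case
    using Cons by (simp add: m_ac)
qed simp

section \<open>Recognising a tensor product; pairings with values in the algebra\<close>

context bimodule_pair
begin

text \<open>\<open>b\<close> induces a map f on the tensor product. Checking \<open>s\<close> after
  f on pure tensors gives injectivity, and surjectivity holds because the values of \<open>b\<close>
  span \<open>G\<close>. \<open>G\<close> is only a group with additive actions, so it may itself be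
  a tensor product.\<close>

lemma tensor_isoI:
  fixes G :: "('r, 'g) bimod"
  assumes G: "comm_group G"
    and lG: "\<And>r. lact G r \<in> hom G G" and rG: "\<And>r. (\<lambda>g. ract G g r) \<in> hom G G"
    and b: "biadditive P Q G b" "balanced P Q b"
    and bl: "\<And>r p q. p \<in> carrier P \<Longrightarrow> q \<in> carrier Q \<Longrightarrow> b (lact P r p) q = lact G r (b p q)"
    and br: "\<And>r p q. p \<in> carrier P \<Longrightarrow> q \<in> carrier Q \<Longrightarrow> b p (ract Q q r) = ract G (b p q) r"
    and s: "s \<in> hom G T" "\<And>p q. p \<in> carrier P \<Longrightarrow> q \<in> carrier Q \<Longrightarrow> s (b p q) = tens P Q p q"
    and surj: "\<And>g. g \<in> carrier G \<Longrightarrow>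
        \<exists>xs. set xs \<subseteq> carrier P \<times> carrier Q \<and> g = gsum G (\<lambda>(p, q). b p q) xs"
  shows "T \<simeq>\<^sub>b G"
proof -
  interpret G: comm_group G by (rule G)
  obtain f where f: "f \<in> hom T G" "\<And>p q. p \<in> carrier P \<Longrightarrow> q \<in> carrier Q \<Longrightarrow> f (tens P Q p q) = b p q"
    using tensor_universal [OF G b] by blast
  have sf: "s (f t) = t" if "t \<in> carrier T" for t
    using tensor_hom_eq [of T "s \<circ> f" id t] that hom_compose [OF f(1) s(1)] T.is_group f(2) s(2)
    by (simp add: hom_def)
  have fs: "f ` carrier T = carrier G"
  proof
    show "f ` carrier T \<subseteq> carrier G"
      using f(1) by (auto intro: hom_in_carrier)
    show "carrier G \<subseteq> f ` carrier T"
    proof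
      fix g assume "g \<in> carrier G"
      then obtain xs where xs: "set xs \<subseteq> carrier P \<times> carrier Q" "g = gsum G (\<lambda>(p, q). b p q) xs"
        using surj by blast
      have c: "(case x of (p, q) \<Rightarrow> tens P Q p q) \<in> carrier T" if "x \<in> set xs" for x
        using that xs(1) tens_closed by auto
      have "f (gsum T (\<lambda>x. case x of (p, q) \<Rightarrow> tens P Q p q) xs) =
          gsum G (\<lambda>x. f (case x of (p, q) \<Rightarrow> tens P Q p q)) xs"
        by (rule hom_gsum [OF T.is_group G.is_group f(1) c])
      also have "\<dots> = g"
        unfolding xs(2) by (rule gsum_cong) (use xs(1) f(2) in auto)
      finally show "g \<in> f ` carrier T"
        by (intro rev_image_eqI [of "gsum T (\<lambda>x. case x of (p, q) \<Rightarrow> tens P Q p q) xs"] T.gsum_closed [OF c]) simp_all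
    qed
  qed
  have "inj_on f (carrier T)"
    by (rule inj_on_inverseI [where g = s]) (rule sf)
  then have "f \<in> iso T G"
    using f(1) fs unfolding iso_def bij_betw_def by blast
  moreover have "f (lact T r t) = lact G r (f t)" if "t \<in> carrier T" for r t
    using tensor_hom_eq [of G "f \<circ> lact T r" "lact G r \<circ> f" t] that
      hom_compose [OF tensor_lact_hom f(1)] hom_compose [OF f(1) lG] G.is_group f(2)
    by (simp add: lact_tens P.lact_closed bl)
  moreover have "f (ract T t r) = ract G (f t) r" if "t \<in> carrier T" for r t
    using tensor_hom_eq [of G "f \<circ> (\<lambda>t. ract T t r)" "(\<lambda>g. ract G g r) \<circ> f" t] that
      hom_compose [OF tensor_ract_hom f(1)] hom_compose [OF f(1) rG] G.is_group f(2)
    by (simp add: ract_tens Q.ract_closed br)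
  ultimately show ?thesis
    unfolding bimod_iso_def by blast
qed

text \<open>\<open>b\<close> factors through the tensor product, where \<phi> is injective; hence a
  sum of values of \<open>b\<close> depends only on the corresponding sum of values of \<phi>.
  Identities in the algebra thus become identities in \<open>G\<close>.\<close>

lemma gsum_pairing_eq:
  assumes inj: "inj_on \<phi> (carrier T)" and \<phi>: "\<phi> \<in> hom T regular_bimod"
    and G: "comm_group G" and b: "biadditive P Q G b" "balanced P Q b"
    and xs: "set xs \<subseteq> carrier P \<times> carrier Q" and ys: "set ys \<subseteq> carrier P \<times> carrier Q"
    and eq: "(\<Sum>(p, q)\<leftarrow>xs. \<phi> (tens P Q p q)) = (\<Sum>(p, q)\<leftarrow>ys. \<phi> (tens P Q p q))"
  shows "gsum G (\<lambda>(p, q). b p q) xs = gsum G (\<lambda>(p, q). b p q) ys"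
proof -
  interpret G: comm_group G by (rule G)
  obtain f where f: "f \<in> hom T G" "\<And>p q. p \<in> carrier P \<Longrightarrow> q \<in> carrier Q \<Longrightarrow> f (tens P Q p q) = b p q"
    using tensor_universal [OF G b] by blast
  let ?t = "\<lambda>x. case x of (p, q) \<Rightarrow> tens P Q p q"
  have c: "?t x \<in> carrier T" if "x \<in> set zs" "set zs \<subseteq> carrier P \<times> carrier Q" for x zs
    using that tens_closed by auto
  have h: "\<phi> (gsum T ?t zs) = (\<Sum>(p, q)\<leftarrow>zs. \<phi> (tens P Q p q))"
      "f (gsum T ?t zs) = gsum G (\<lambda>(p, q). b p q) zs"
    if zs: "set zs \<subseteq> carrier P \<times> carrier Q" for zs
  proof -
    have "\<phi> (gsum T ?t zs) = gsum regular_bimod (\<lambda>x. \<phi> (?t x)) zs"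
      by (rule hom_gsum [OF T.is_group _ \<phi> c]) (use zs P.group_regular in auto)
    then show "\<phi> (gsum T ?t zs) = (\<Sum>(p, q)\<leftarrow>zs. \<phi> (tens P Q p q))"
      by (simp add: gsum_regular prod.case_distrib)
    have "f (gsum T ?t zs) = gsum G (\<lambda>x. f (?t x)) zs"
      by (rule hom_gsum [OF T.is_group G.is_group f(1) c]) (use zs in auto)
    also have "\<dots> = gsum G (\<lambda>(p, q). b p q) zs"
      by (rule gsum_cong) (use zs f(2) in auto)
    finally show "f (gsum T ?t zs) = gsum G (\<lambda>(p, q). b p q) zs" .
  qed
  have "gsum T ?t xs = gsum T ?t ys"
    by (rule inj_onD [OF inj])
      (use h(1) [OF xs] h(1) [OF ys] eq T.gsum_closed [OF c [OF _ xs]] T.gsum_closed [OF c [OF _ ys]] in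
        simp_all)
  then show ?thesis
    using h(2) [OF xs] h(2) [OF ys] by simp
qed

text \<open>These expansions of the unit later supply the dual basis and the generator
  property.\<close>

lemma pairing_list:
  assumes "\<phi> \<in> iso T regular_bimod"
  obtains xs where "set xs \<subseteq> carrier P \<times> carrier Q" "(\<Sum>(p, q)\<leftarrow>xs. \<phi> (tens P Q p q)) = 1"
proof -
  have "\<phi> ` carrier T = UNIV" and \<phi>: "\<phi> \<in> hom T regular_bimod"
    using assms by (simp_all add: iso_def bij_betw_def)
  then obtain t where t: "t \<in> carrier T" "\<phi> t = 1"
    by (metis UNIV_I imageE)
  then obtain xs where xs: "set xs \<subseteq> carrier P \<times> carrier Q" "t = gsum T (\<lambda>(p, q). tens P Q p q) xs"
    using tensor_list by blast
  have "\<phi> t = gsum regular_bimod (\<lambda>x. \<phi> (case x of (p, q) \<Rightarrow> tens P Q p q)) xs"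
    unfolding xs(2)
    by (rule hom_gsum [OF T.is_group P.group_regular \<phi>])
      (use xs(1) tens_closed in \<open>auto\<close>)
  then show ?thesis
    using that xs(1) t(2) by (simp add: gsum_regular prod.case_distrib)
qed

lemma biadditive_compose:
  assumes "f \<in> hom T G"
  shows "biadditive P Q G (\<lambda>p q. f (tens P Q p q))"
  unfolding biadditive_def
proof (intro conjI ballI)
  fix p assume "p \<in> carrier P"
  then show "(\<lambda>q. f (tens P Q p q)) \<in> hom Q G"
    using hom_compose [OF _ assms, of "tens P Q p" Q] tens_biadditive by (simp add: biadditive_def comp_def)
next
  fix q assume "q \<in> carrier Q"
  then show "(\<lambda>p. f (tens P Q p q)) \<in> hom P G"
    using hom_compose [OF _ assms, of "\<lambda>p. tens P Q p q" P] tens_biadditive by (simp add: biadditive_def comp_def)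
qed

end

lemma tensor_cong:
  assumes U: "bimodule scale U" and V: "bimodule scale V" and P: "bimodule scale P" and Q: "bimodule scale Q"
    and "U \<simeq>\<^sub>b P" "V \<simeq>\<^sub>b Q"
  shows "tensor_bimod U V \<simeq>\<^sub>b tensor_bimod P Q"
proof -
  interpret UV: bimodule_pair scale U V
    using U V by (rule bimodule_pairI)
  interpret PQ: bimodule_pair scale P Q
    using P Q by (rule bimodule_pairI)
  obtain f where f: "f \<in> iso U P"
    and fl: "\<And>m r. m \<in> carrier U \<Longrightarrow> f (lact U r m) = lact P r (f m)"
    and fr: "\<And>m r. m \<in> carrier U \<Longrightarrow> f (ract U m r) = ract P (f m) r"
    using assms(5) unfolding bimod_iso_def by blast
  obtain g where g: "g \<in> iso V Q"
    and gl: "\<And>m r. m \<in> carrier V \<Longrightarrow> g (lact V r m) = lact Q r (g m)"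
    and gr: "\<And>m r. m \<in> carrier V \<Longrightarrow> g (ract V m r) = ract Q (g m) r"
    using assms(6) unfolding bimod_iso_def by blast
  let ?f = "inv_into (carrier U) f" and ?g = "inv_into (carrier V) g"
  have f': "?f \<in> iso P U" and g': "?g \<in> iso Q V"
    by (auto intro: UV.P.iso_set_sym [OF f] UV.Q.iso_set_sym [OF g])
  have fc: "f u \<in> carrier P" and ff: "?f (f u) = u" if "u \<in> carrier U" for u
    using f that by (auto simp: iso_def bij_betw_def)
  have gc: "g v \<in> carrier Q" and gg: "?g (g v) = v" if "v \<in> carrier V" for v
    using g that by (auto simp: iso_def bij_betw_def)
  have fc': "?f p \<in> carrier U" and ff': "f (?f p) = p" if "p \<in> carrier P" for p
    using f that by (auto simp: iso_def bij_betw_def inv_into_into f_inv_into_f)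
  have gc': "?g q \<in> carrier V" and gg': "g (?g q) = q" if "q \<in> carrier Q" for q
    using g that by (auto simp: iso_def bij_betw_def inv_into_into f_inv_into_f)
  have fr': "?f (ract P p r) = ract U (?f p) r" if "p \<in> carrier P" for p r
    using ff [OF UV.P.ract_closed [OF fc' [OF that]], of r] fr [OF fc' [OF that], of r] ff' [OF that] by simp
  have gl': "?g (lact Q r q) = lact V r (?g q)" if "q \<in> carrier Q" for q r
    using gg [OF UV.Q.lact_closed [OF gc' [OF that]], of r] gl [OF gc' [OF that], of r] gg' [OF that] by simp
  have fh: "f \<in> hom U P" and gh: "g \<in> hom V Q" and fh': "?f \<in> hom P U" and gh': "?g \<in> hom Q V"
    using f g f' g' by (auto simp: iso_def)
  have b: "biadditive U V PQ.T (\<lambda>u v. tens P Q (f u) (g v))"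
    unfolding biadditive_def
  proof (intro conjI ballI)
    fix u assume "u \<in> carrier U"
    then show "(\<lambda>v. tens P Q (f u) (g v)) \<in> hom V PQ.T"
      using hom_compose [OF gh, of "tens P Q (f u)" PQ.T] PQ.tens_biadditive fc
      by (simp add: biadditive_def comp_def)
  next
    fix v assume "v \<in> carrier V"
    then show "(\<lambda>u. tens P Q (f u) (g v)) \<in> hom U PQ.T"
      using hom_compose [OF fh, of "\<lambda>p. tens P Q p (g v)" PQ.T] PQ.tens_biadditive gc
      by (simp add: biadditive_def comp_def)
  qed
  have b': "biadditive P Q UV.T (\<lambda>p q. tens U V (?f p) (?g q))"
    unfolding biadditive_def
  proof (intro conjI ballI)
    fix p assume "p \<in> carrier P"
    then show "(\<lambda>q. tens U V (?f p) (?g q)) \<in> hom Q UV.T"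
      using hom_compose [OF gh', of "tens U V (?f p)" UV.T] UV.tens_biadditive fc'
      by (simp add: biadditive_def comp_def)
  next
    fix q assume "q \<in> carrier Q"
    then show "(\<lambda>p. tens U V (?f p) (?g q)) \<in> hom P UV.T"
      using hom_compose [OF fh', of "\<lambda>u. tens U V u (?g q)" UV.T] UV.tens_biadditive gc'
      by (simp add: biadditive_def comp_def)
  qed
  have "balanced P Q (\<lambda>p q. tens U V (?f p) (?g q))"
    using UV.tens_balanced fc' gc' by (simp add: balanced_def fr' gl')
  then obtain s where s: "s \<in> hom PQ.T UV.T"
    "\<And>p q. p \<in> carrier P \<Longrightarrow> q \<in> carrier Q \<Longrightarrow> s (tens P Q p q) = tens U V (?f p) (?g q)"
    using PQ.tensor_universal [OF UV.T.comm_group_axioms b'] by blast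
  show ?thesis
  proof (rule UV.tensor_isoI [OF PQ.T.comm_group_axioms PQ.tensor_lact_hom PQ.tensor_ract_hom b])
    show "balanced U V (\<lambda>u v. tens P Q (f u) (g v))"
      using PQ.tens_balanced fc gc by (simp add: balanced_def fr gl)
    show "s \<in> hom PQ.T UV.T"
      by (rule s(1))
    fix t assume "t \<in> carrier PQ.T"
    then obtain xs where xs: "set xs \<subseteq> carrier P \<times> carrier Q" "t = gsum PQ.T (\<lambda>(p, q). tens P Q p q) xs"
      using PQ.tensor_list by blast
    then have "gsum PQ.T (\<lambda>(u, v). tens P Q (f u) (g v)) (map (\<lambda>(p, q). (?f p, ?g q)) xs) = t"
      unfolding gsum_map by (auto intro!: gsum_cong simp: ff' gg')
    moreover have "set (map (\<lambda>(p, q). (?f p, ?g q)) xs) \<subseteq> carrier U \<times> carrier V"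
      using xs(1) fc' gc' by auto
    ultimately show "\<exists>ys. set ys \<subseteq> carrier U \<times> carrier V \<and> t = gsum PQ.T (\<lambda>(u, v). tens P Q (f u) (g v)) ys"
      by metis
  qed (simp_all add: fc gc fl gr s(2) ff gg PQ.lact_tens PQ.ract_tens)
qed

section \<open>Invertible bimodules are progenerators\<close>

definition llin :: "('r, 'm) bimod \<Rightarrow> ('r, 'n) bimod \<Rightarrow> ('m \<Rightarrow> 'n) set" where
  "llin M N = {f \<in> hom M N. \<forall>m \<in> carrier M. \<forall>r. f (lact M r m) = lact N r (f m)}"

lemma llinI:
  assumes "\<And>m. m \<in> carrier M \<Longrightarrow> f m \<in> carrier N"
    and "\<And>m n. m \<in> carrier M \<Longrightarrow> n \<in> carrier M \<Longrightarrow> f (m \<otimes>\<^bsub>M\<^esub> n) = f m \<otimes>\<^bsub>N\<^esub> f n"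
    and "\<And>m r. m \<in> carrier M \<Longrightarrow> f (lact M r m) = lact N r (f m)"
  shows "f \<in> llin M N"
  using assms by (simp add: llin_def hom_def)

lemma llin_closed: "f \<in> llin M N \<Longrightarrow> m \<in> carrier M \<Longrightarrow> f m \<in> carrier N"
  and llin_add: "f \<in> llin M N \<Longrightarrow> m \<in> carrier M \<Longrightarrow> n \<in> carrier M \<Longrightarrow> f (m \<otimes>\<^bsub>M\<^esub> n) = f m \<otimes>\<^bsub>N\<^esub> f n"
  and llin_lact: "f \<in> llin M N \<Longrightarrow> m \<in> carrier M \<Longrightarrow> f (lact M r m) = lact N r (f m)"
  and llin_hom: "f \<in> llin M N \<Longrightarrow> f \<in> hom M N"
  by (auto simp: llin_def hom_def)

text \<open>Let a and c be the pairings P x Q and Q x P obtained from the two isomorphisms. For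
  fixed x the map p \<otimes> q \<mapsto> p c(q, x) factors through the first isomorphism, so it
  equals a(p, q) \<theta>(x) with \<theta>(x) its value at 1. Expanding 1 in values of c gives a
  dual basis, expanding it in values of a shows that P is a generator.\<close>

lemma invertible_bimod_progenerator:
  fixes P :: "('r::ring_1, 'p) bimod" and scale :: "'k::field \<Rightarrow> 'r \<Rightarrow> 'r"
  assumes "invertible_bimod TYPE('q) scale P"
  shows invertible_dual_basis: "\<exists>L. set L \<subseteq> llin P regular_bimod \<times> carrier P \<and>
      (\<forall>p \<in> carrier P. p = gsum P (\<lambda>(f, x). lact P (f p) x) L)"
    and invertible_generator: "\<exists>L. set L \<subseteq> llin P regular_bimod \<times> carrier P \<and> (\<Sum>(f, x)\<leftarrow>L. f x) = 1"
    and invertible_llin_ract: "\<And>h. h \<in> llin P P \<Longrightarrow> \<exists>r. \<forall>p \<in> carrier P. h p = ract P p r"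
    and invertible_ract_faithful: "\<And>r. (\<forall>p \<in> carrier P. ract P p r = \<one>\<^bsub>P\<^esub>) \<Longrightarrow> r = 0"
proof -
  obtain Q :: "('r, 'q) bimod" where P: "bimodule scale P" and Q: "bimodule scale Q"
    and PQ: "tensor_bimod P Q \<simeq>\<^sub>b regular_bimod" and QP: "regular_bimod \<simeq>\<^sub>b tensor_bimod Q P"
    using assms unfolding invertible_bimod_def by blast
  interpret PQ: bimodule_pair scale P Q
    using P Q by (rule bimodule_pairI)
  interpret QP: bimodule_pair scale Q P
    using Q P by (rule bimodule_pairI)
  note gr = PQ.P.group_regular
  obtain \<phi> where \<phi>: "\<phi> \<in> iso PQ.T regular_bimod"
    and \<phi>l: "\<And>t r. t \<in> carrier PQ.T \<Longrightarrow> \<phi> (lact PQ.T r t) = r * \<phi> t"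
    and \<phi>r: "\<And>t r. t \<in> carrier PQ.T \<Longrightarrow> \<phi> (ract PQ.T t r) = \<phi> t * r"
    using PQ unfolding bimod_iso_def regular_bimod_simps by blast
  obtain \<psi> where \<psi>: "\<psi> \<in> iso QP.T regular_bimod"
    and \<psi>l: "\<And>t r. t \<in> carrier QP.T \<Longrightarrow> \<psi> (lact QP.T r t) = r * \<psi> t"
    and \<psi>r: "\<And>t r. t \<in> carrier QP.T \<Longrightarrow> \<psi> (ract QP.T t r) = \<psi> t * r"
    using bimod_iso_sym [OF gr _ _ QP] unfolding bimod_iso_def regular_bimod_simps by blast
  define a where "a = (\<lambda>p q. \<phi> (tens P Q p q))"
  define c where "c = (\<lambda>q p. \<psi> (tens Q P q p))"
  have \<phi>h: "\<phi> \<in> hom PQ.T regular_bimod" and \<psi>h: "\<psi> \<in> hom QP.T regular_bimod"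
    and \<phi>i: "inj_on \<phi> (carrier PQ.T)"
    using \<phi> \<psi> by (auto simp: iso_def bij_betw_def)
  have al: "a (lact P r p) q = r * a p q" and ar: "a p (ract Q q r) = a p q * r"
    if "p \<in> carrier P" "q \<in> carrier Q" for p q r
    using that \<phi>l \<phi>r PQ.tens_closed by (simp_all add: a_def flip: PQ.lact_tens PQ.ract_tens)
  have cl: "c (lact Q r q) p = r * c q p" and cr: "c q (ract P p r) = c q p * r"
    and cb: "c q (lact P r p) = c (ract Q q r) p"
    if "p \<in> carrier P" "q \<in> carrier Q" for p q r
    using that \<psi>l \<psi>r QP.tens_closed QP.tens_balanced
    by (simp_all add: c_def balanced_def flip: QP.lact_tens QP.ract_tens)
  have aB: "biadditive P Q regular_bimod a" and cB: "biadditive Q P regular_bimod c"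
    unfolding a_def c_def
    by (rule PQ.biadditive_compose [OF \<phi>h], rule QP.biadditive_compose [OF \<psi>h])
  have a1: "a (p \<otimes>\<^bsub>P\<^esub> p') q = a p q + a p' q" if "p \<in> carrier P" "p' \<in> carrier P" "q \<in> carrier Q" for p p' q
    using aB that hom_mult [of "\<lambda>p. a p q" P regular_bimod p p'] by (simp add: biadditive_def)
  have c1: "c (q \<otimes>\<^bsub>Q\<^esub> q') p = c q p + c q' p" if "q \<in> carrier Q" "q' \<in> carrier Q" "p \<in> carrier P" for p q q'
    using cB that hom_mult [of "\<lambda>q. c q p" Q regular_bimod q q'] by (simp add: biadditive_def)
  have c2: "c q (p \<otimes>\<^bsub>P\<^esub> p') = c q p + c q p'" if "q \<in> carrier Q" "p \<in> carrier P" "p' \<in> carrier P" for q p p'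
    using cB that hom_mult [of "c q" P regular_bimod p p'] by (simp add: biadditive_def)
  have c0: "c q \<one>\<^bsub>P\<^esub> = 0" if "q \<in> carrier Q" for q
    using cB that hom_one [of "c q" P regular_bimod] PQ.P.is_group gr by (simp add: biadditive_def)
  obtain xs where xs: "set xs \<subseteq> carrier P \<times> carrier Q" "(\<Sum>(p, q)\<leftarrow>xs. a p q) = 1"
    unfolding a_def using PQ.pairing_list [OF \<phi>] .
  obtain ys where ys: "set ys \<subseteq> carrier Q \<times> carrier P" "(\<Sum>(q, p)\<leftarrow>ys. c q p) = 1"
    unfolding c_def using QP.pairing_list [OF \<psi>] .
  have xsD: "p \<in> carrier P" "q \<in> carrier Q" if "(p, q) \<in> set xs" for p q
    using that xs(1) by auto
  have ysD: "q \<in> carrier Q" "p \<in> carrier P" if "(q, p) \<in> set ys" for p q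
    using that ys(1) by auto
  \<comment> \<open>The two pairings need not be compatible: \<open>\<theta>\<close> measures the failure of
    \<open>[p, q] x = p \<langle>q, x\<rangle>\<close>.\<close>
  define \<theta> where "\<theta> = (\<lambda>x. gsum P (\<lambda>(p, q). ract P p (c q x)) xs)"
  have bB: "biadditive P Q P (\<lambda>p q. ract P p (c q x))" "balanced P Q (\<lambda>p q. ract P p (c q x))"
    if x: "x \<in> carrier P" for x
  proof -
    show "biadditive P Q P (\<lambda>p q. ract P p (c q x))"
      unfolding biadditive_def using x
      by (auto intro!: homI simp: PQ.P.ract_closed PQ.P.ract_add PQ.P.add_ract c1)
    show "balanced P Q (\<lambda>p q. ract P p (c q x))"
      unfolding balanced_def using x by (simp add: PQ.P.ract_mult cl)
  qed
  have eq: "gsum P (\<lambda>(p, q). ract P p (c q x)) us = gsum P (\<lambda>(p, q). ract P p (c q x)) vs"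
    if "x \<in> carrier P" "set us \<subseteq> carrier P \<times> carrier Q" "set vs \<subseteq> carrier P \<times> carrier Q"
      "(\<Sum>(p, q)\<leftarrow>us. a p q) = (\<Sum>(p, q)\<leftarrow>vs. a p q)" for x us vs
    by (rule PQ.gsum_pairing_eq [OF \<phi>i \<phi>h PQ.P.comm_group_axioms bB [OF that(1)] that(2,3)])
      (use that(4) in \<open>simp add: a_def\<close>)
  let ?xl = "\<lambda>r. map (\<lambda>(p, q). (lact P r p, q)) xs" and ?xr = "\<lambda>r. map (\<lambda>(p, q). (p, ract Q q r)) xs"
  have xl: "set (?xl r) \<subseteq> carrier P \<times> carrier Q" "(\<Sum>(p, q)\<leftarrow>?xl r. a p q) = r" for r
  proof -
    show "set (?xl r) \<subseteq> carrier P \<times> carrier Q"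
      using xsD by (auto simp: PQ.P.lact_closed)
    have "(\<Sum>(p, q)\<leftarrow>?xl r. a p q) = (\<Sum>x\<leftarrow>xs. r * (case x of (p, q) \<Rightarrow> a p q))"
      unfolding map_map comp_def by (rule arg_cong [of _ _ sum_list], rule map_cong) (use xsD in \<open>auto simp: al\<close>)
    then show "(\<Sum>(p, q)\<leftarrow>?xl r. a p q) = r"
      using xs(2) by (simp add: sum_list_const_mult)
  qed
  have xr: "set (?xr r) \<subseteq> carrier P \<times> carrier Q" "(\<Sum>(p, q)\<leftarrow>?xr r. a p q) = r" for r
  proof -
    show "set (?xr r) \<subseteq> carrier P \<times> carrier Q"
      using xsD by (auto simp: PQ.Q.ract_closed)
    have "(\<Sum>(p, q)\<leftarrow>?xr r. a p q) = (\<Sum>x\<leftarrow>xs. (case x of (p, q) \<Rightarrow> a p q) * r)"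
      unfolding map_map comp_def by (rule arg_cong [of _ _ sum_list], rule map_cong) (use xsD in \<open>auto simp: ar\<close>)
    then show "(\<Sum>(p, q)\<leftarrow>?xr r. a p q) = r"
      using xs(2) by (simp add: sum_list_mult_const)
  qed
  have xlg: "gsum P (\<lambda>(p, q). ract P p (c q x)) (?xl r) = lact P r (\<theta> x)" if x: "x \<in> carrier P" for x r
  proof -
    have "lact P r (\<theta> x) = gsum P (\<lambda>z. lact P r (case z of (p, q) \<Rightarrow> ract P p (c q x))) xs"
      unfolding \<theta>_def
      by (rule hom_gsum [OF PQ.P.is_group PQ.P.is_group PQ.P.lact_hom]) (use xsD in \<open>auto simp: PQ.P.ract_closed\<close>)
    also have "\<dots> = gsum P (\<lambda>(p, q). ract P p (c q x)) (?xl r)"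
      unfolding gsum_map by (rule gsum_cong) (use xsD in \<open>auto simp: PQ.P.lact_ract\<close>)
    finally show ?thesis ..
  qed
  \<comment> \<open>Both sides evaluate the same balanced map on lists representing a(p, q): the
    one-term list and the expansion \<open>?xl (a p q)\<close>.\<close>
  have key: "ract P p (c q x) = lact P (a p q) (\<theta> x)" if "p \<in> carrier P" "q \<in> carrier Q" "x \<in> carrier P" for p q x
    using eq [OF that(3) _ xl(1) , of "[(p, q)]" "a p q"] that xl(2) xlg [OF that(3)]
    by (simp add: PQ.P.ract_closed)
  have \<theta>: "\<theta> \<in> llin P P"
  proof (rule llinI)
    fix x assume x: "x \<in> carrier P"
    show "\<theta> x \<in> carrier P"
      unfolding \<theta>_def by (rule PQ.P.gsum_closed) (use xsD in \<open>auto simp: PQ.P.ract_closed\<close>)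
    show "\<theta> (lact P r x) = lact P r (\<theta> x)" for r
    proof -
      \<comment> \<open>The factor r passes from x to q because \<open>c\<close> is
        balanced.\<close>
      have "\<theta> (lact P r x) = gsum P (\<lambda>(p, q). ract P p (c q x)) (?xr r)"
        unfolding \<theta>_def gsum_map by (rule gsum_cong) (use xsD x in \<open>auto simp: cb\<close>)
      also have "\<dots> = gsum P (\<lambda>(p, q). ract P p (c q x)) (?xl r)"
        by (rule eq [OF x xr(1) xl(1)]) (simp only: xl(2) xr(2))
      finally show ?thesis
        using xlg [OF x] by simp
    qed
    fix y assume y: "y \<in> carrier P"
    have "\<theta> (x \<otimes>\<^bsub>P\<^esub> y) = gsum P (\<lambda>z. (case z of (p, q) \<Rightarrow> ract P p (c q x)) \<otimes>\<^bsub>P\<^esub> (case z of (p, q) \<Rightarrow> ract P p (c q y))) xs"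
      unfolding \<theta>_def by (rule gsum_cong) (use xsD x y in \<open>auto simp: c2 PQ.P.add_ract\<close>)
    also have "\<dots> = \<theta> x \<otimes>\<^bsub>P\<^esub> \<theta> y"
      unfolding \<theta>_def by (rule PQ.P.gsum_mult) (use xsD in \<open>auto simp: PQ.P.ract_closed\<close>)
    finally show "\<theta> (x \<otimes>\<^bsub>P\<^esub> y) = \<theta> x \<otimes>\<^bsub>P\<^esub> \<theta> y" .
  qed
  have ractsum: "gsum P (\<lambda>(q, x). ract P p (c q (y x))) ys = ract P p (\<Sum>(q, x)\<leftarrow>ys. c q (y x))"
    if "p \<in> carrier P" for p y
  proof -
    have "ract P p (\<Sum>(q, x)\<leftarrow>ys. c q (y x)) = ract P p (gsum regular_bimod (\<lambda>(q, x). c q (y x)) ys)"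
      by (simp add: gsum_regular)
    also have "\<dots> = gsum P (\<lambda>z. ract P p (case z of (q, x) \<Rightarrow> c q (y x))) ys"
      by (rule hom_gsum [OF gr PQ.P.is_group PQ.P.ract_hom_right [OF that]]) simp
    finally show ?thesis
      by (simp add: prod.case_distrib)
  qed
  have dual: "p = gsum P (\<lambda>(q, x). lact P (a p q) (\<theta> x)) ys" if p: "p \<in> carrier P" for p
  proof -
    have "gsum P (\<lambda>(q, x). lact P (a p q) (\<theta> x)) ys = gsum P (\<lambda>(q, x). ract P p (c q x)) ys"
      by (rule gsum_cong) (use ysD p key in auto)
    also have "\<dots> = p"
      using ractsum [OF p, of id] ys(2) PQ.P.ract_one [OF p] by simp
    finally show ?thesis ..
  qed
  have afun: "(\<lambda>p. a p q) \<in> llin P regular_bimod" if "q \<in> carrier Q" for q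
    by (rule llinI) (use that in \<open>auto simp: al a1\<close>)
  show "\<exists>L. set L \<subseteq> llin P regular_bimod \<times> carrier P \<and>
      (\<forall>p \<in> carrier P. p = gsum P (\<lambda>(f, x). lact P (f p) x) L)"
  proof (intro exI conjI ballI)
    let ?L = "map (\<lambda>(q, x). ((\<lambda>p. a p q), \<theta> x)) ys"
    show "set ?L \<subseteq> llin P regular_bimod \<times> carrier P"
      using ysD afun llin_closed [OF \<theta>] by auto
    show "p = gsum P (\<lambda>(f, x). lact P (f p) x) ?L" if "p \<in> carrier P" for p
      using dual [OF that] unfolding gsum_map comp_def by (simp add: case_prod_beta')
  qed
  show "\<exists>L. set L \<subseteq> llin P regular_bimod \<times> carrier P \<and> (\<Sum>(f, x)\<leftarrow>L. f x) = 1"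
  proof (intro exI conjI)
    let ?L = "map (\<lambda>(p, q). ((\<lambda>p. a p q), p)) xs"
    show "set ?L \<subseteq> llin P regular_bimod \<times> carrier P"
      using xsD afun by auto
    show "(\<Sum>(f, x)\<leftarrow>?L. f x) = 1"
      using xs(2) by (simp add: comp_def case_prod_beta')
  qed
  show "\<exists>r. \<forall>p \<in> carrier P. h p = ract P p r" if h: "h \<in> llin P P" for h
  proof -
    \<comment> \<open>The dual basis expresses z through values of \<theta>, so \<theta> is onto.
      Hence each h(\<theta> x) is again of the form \<theta>(y x), and \<open>key\<close> turns h
      into a right multiplication.\<close>
    have surj: "\<exists>y \<in> carrier P. \<theta> y = z" if z: "z \<in> carrier P" for z
    proof
      let ?y = "gsum P (\<lambda>(q, x). lact P (a z q) x) ys"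
      have c: "(case u of (q, x) \<Rightarrow> lact P (a z q) x) \<in> carrier P" if "u \<in> set ys" for u
        using that ysD by (auto simp: PQ.P.lact_closed split: prod.split)
      show "?y \<in> carrier P"
        by (rule PQ.P.gsum_closed [OF c])
      have "\<theta> ?y = gsum P (\<lambda>u. \<theta> (case u of (q, x) \<Rightarrow> lact P (a z q) x)) ys"
        by (rule hom_gsum [OF PQ.P.is_group PQ.P.is_group llin_hom [OF \<theta>] c])
      also have "\<dots> = gsum P (\<lambda>(q, x). lact P (a z q) (\<theta> x)) ys"
        by (rule gsum_cong) (use ysD llin_lact [OF \<theta>] in auto)
      finally show "\<theta> ?y = z"
        using dual [OF z] by simp
    qed
    have "\<forall>x \<in> carrier P. \<exists>y. y \<in> carrier P \<and> \<theta> y = h (\<theta> x)"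
      using surj llin_closed [OF h] llin_closed [OF \<theta>] by blast
    then obtain y where y: "\<And>x. x \<in> carrier P \<Longrightarrow> y x \<in> carrier P \<and> \<theta> (y x) = h (\<theta> x)"
      by metis
    have "h p = ract P p (\<Sum>(q, x)\<leftarrow>ys. c q (y x))" if p: "p \<in> carrier P" for p
    proof -
      have "h p = h (gsum P (\<lambda>(q, x). lact P (a p q) (\<theta> x)) ys)"
        using dual [OF p] by simp
      also have "\<dots> = gsum P (\<lambda>u. h (case u of (q, x) \<Rightarrow> lact P (a p q) (\<theta> x))) ys"
        by (rule hom_gsum [OF PQ.P.is_group PQ.P.is_group llin_hom [OF h]])
          (use ysD llin_closed [OF \<theta>] in \<open>auto simp: PQ.P.lact_closed\<close>)
      also have "\<dots> = gsum P (\<lambda>(q, x). ract P p (c q (y x))) ys"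
        by (rule gsum_cong)
          (use ysD p y llin_closed [OF \<theta>] llin_lact [OF h] in \<open>auto simp: key\<close>)
      finally show ?thesis
        using ractsum [OF p] by simp
    qed
    then show ?thesis by blast
  qed
  show "r = 0" if r: "\<forall>p \<in> carrier P. ract P p r = \<one>\<^bsub>P\<^esub>" for r
  proof -
    \<comment> \<open>As 1 is a sum of values c(q, x), r is the sum of the c(q, x r), and every x r
      vanishes.\<close>
    have "r = (\<Sum>(q, x)\<leftarrow>ys. c q x) * r"
      using ys(2) by simp
    also have "\<dots> = (\<Sum>u\<leftarrow>ys. (case u of (q, x) \<Rightarrow> c q x) * r)"
      by (simp add: sum_list_mult_const)
    also have "\<dots> = (\<Sum>u\<leftarrow>ys. 0)"
      by (rule arg_cong [of _ _ sum_list], rule map_cong)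
        (use ysD r c0 in \<open>auto simp flip: cr\<close>)
    finally show ?thesis by simp
  qed
qed

section \<open>Transport of structure\<close>

text \<open>The classes in \<open>Pic\<close> contain only bimodules on subsets of
  \<open>nat \<Rightarrow> 'r\<close>, so a bimodule carried by another type has to be copied
  there.\<close>

definition copy_bimod :: "('m \<Rightarrow> 'n) \<Rightarrow> ('r, 'm) bimod \<Rightarrow> ('r, 'n) bimod" where
  "copy_bimod \<iota> M = (let j = inv_into (carrier M) \<iota> in
     \<lparr>carrier = \<iota> ` carrier M, monoid.mult = (\<lambda>x y. \<iota> (j x \<otimes>\<^bsub>M\<^esub> j y)), one = \<iota> \<one>\<^bsub>M\<^esub>,
      lact = (\<lambda>r x. \<iota> (lact M r (j x))), ract = (\<lambda>x r. \<iota> (ract M (j x) r))\<rparr>)"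

context bimodule
begin

lemma copy_bimod:
  assumes \<iota>: "inj_on \<iota> (carrier M)"
  shows bimodule_copy: "bimodule scale (copy_bimod \<iota> M)"
    and copy_bimod_iso: "M \<simeq>\<^sub>b copy_bimod \<iota> M"
proof -
  let ?N = "copy_bimod \<iota> M"
  have C: "carrier ?N = \<iota> ` carrier M" "one ?N = \<iota> \<one>"
    and N: "\<And>m n. m \<in> carrier M \<Longrightarrow> n \<in> carrier M \<Longrightarrow> monoid.mult ?N (\<iota> m) (\<iota> n) = \<iota> (m \<otimes> n)"
      "\<And>m r. m \<in> carrier M \<Longrightarrow> lact ?N r (\<iota> m) = \<iota> (lact M r m)"
      "\<And>m r. m \<in> carrier M \<Longrightarrow> ract ?N (\<iota> m) r = \<iota> (ract M m r)"
    using \<iota> by (simp_all add: copy_bimod_def Let_def)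
  have "comm_group ?N"
  proof (rule comm_groupI)
    fix x assume "x \<in> carrier ?N"
    then obtain m where "m \<in> carrier M" "x = \<iota> m" by (auto simp: C)
    then show "\<exists>y \<in> carrier ?N. y \<otimes>\<^bsub>?N\<^esub> x = \<one>\<^bsub>?N\<^esub>"
      by (auto simp: C N intro!: bexI [of _ "inv m"])
  qed (auto simp: C N m_ac)
  then show "bimodule scale ?N"
    by (intro bimodule.intro bimodule_axioms.intro k_algebra_axioms)
      (auto simp: C N lact_closed ract_closed lact_add add_lact lact_mult lact_one
        ract_add add_ract ract_mult ract_one lact_ract central)
  have "\<iota> \<in> iso M ?N"
    using \<iota> by (auto simp: iso_def hom_def bij_betw_def C N)
  then show "M \<simeq>\<^sub>b ?N"
    unfolding bimod_iso_def by (intro bexI [of _ \<iota>]) (simp_all add: N)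
qed

end

section \<open>The algebra as the even part of a graded algebra\<close>

text \<open>With \<open>A = M\<^sub>3(K[x]/(x\<^sup>2))\<close>, blocked as \<open>1 + 2\<close>, put the off-diagonal blocks and \<open>x\<close> in
  odd degree. The even part of \<open>A\<close> is \<open>R\<close> and its odd part is \<open>R\<^sup>*\<close>. A homogeneous element is
  stored by the nine coefficients of its entries, and \<open>gmul s t\<close> multiplies elements of degrees
  \<open>s\<close> and \<open>t\<close> (\<^const>\<open>True\<close> is odd); a product of entries is dropped when it carries \<open>x\<^sup>2\<close>.\<close>

definition gmul :: "bool \<Rightarrow> bool \<Rightarrow> 'k::field ralg \<Rightarrow> 'k ralg \<Rightarrow> 'k ralg" where
  "gmul s t a b = RAlg (\<lambda>c. case c of
      BE \<Rightarrow> (if s \<and> t then 0 else coord a BE * coord b BE) +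
        (if s \<or> t then coord a (BX I1) * coord b (BY I1) + coord a (BX I2) * coord b (BY I2) else 0)
    | BX j \<Rightarrow> (if s \<and> \<not> t then 0 else coord a BE * coord b (BX j)) +
        (if t \<and> \<not> s then 0 else coord a (BX I1) * coord b (BF I1 j) + coord a (BX I2) * coord b (BF I2 j))
    | BY i \<Rightarrow> (if t \<and> \<not> s then 0 else coord a (BY i) * coord b BE) +
        (if s \<and> \<not> t then 0 else coord a (BF i I1) * coord b (BY I1) + coord a (BF i I2) * coord b (BY I2))
    | BF i j \<Rightarrow> (if s \<or> t then coord a (BY i) * coord b (BX j) else 0) +
        (if s \<and> t then 0 else coord a (BF i I1) * coord b (BF I1 j) + coord a (BF i I2) * coord b (BF I2 j)))"

lemma coord_simps [simp]:
  "coord 0 c = (0 :: 'k::field)" "coord (a + b) c = coord a c + (coord b c :: 'k)"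
  "coord (rscale k a) c = k * (coord a c :: 'k)"
  by (simp_all add: zero_ralg_def plus_ralg_def rscale_def)

lemma coord_one: "coord 1 c = (if c = BE \<or> c = BF I1 I1 \<or> c = BF I2 I2 then 1 else 0 :: 'k::field)"
  by (simp add: one_ralg_def)

lemma coord_basis_elem: "coord (basis_elem b) c = (if c = b then 1 else 0 :: 'k::field)"
  by (simp add: basis_elem_def)

lemma gmul_False [simp]: "gmul False False a b = a * b"
  by (rule ralg_eqI, rename_tac c, case_tac c) (simp_all add: coord_times gmul_def)

lemma gmul_add_left: "gmul s t (a + b) c = gmul s t a c + gmul s t b c"
  by (rule ralg_eqI, rename_tac x, case_tac x) (simp_all add: gmul_def algebra_simps)

lemma gmul_add_right: "gmul s t a (b + c) = gmul s t a b + gmul s t a c"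
  by (rule ralg_eqI, rename_tac x, case_tac x) (simp_all add: gmul_def algebra_simps)

lemma gmul_zero [simp]: "gmul s t 0 a = 0" "gmul s t a 0 = 0"
  by (rule ralg_eqI, rename_tac x, case_tac x; simp add: gmul_def)+

lemma gmul_scale: "gmul s t (rscale k a) b = rscale k (gmul s t a b)"
    "gmul s t a (rscale k b) = rscale k (gmul s t a b)"
  by (rule ralg_eqI, rename_tac x, case_tac x; simp add: gmul_def algebra_simps)+

text \<open>Degrees add modulo 2, which on Booleans is inequality. The compatibilities of the
  products with the actions (\<open>gmul_act\<close>, \<open>gmul_pairing\<close>,
  \<open>gmul_cancel_left\<close>) are instances.\<close>

lemma gmul_assoc: "gmul (s \<noteq> t) u (gmul s t a b) c = gmul s (t \<noteq> u) a (gmul t u b c)"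
  by (rule ralg_eqI, rename_tac x, case_tac x; cases s; cases t; cases u)
    (simp_all add: gmul_def algebra_simps)

lemma ralg_eq_iff:
  fixes a b :: "'k::field ralg"
  shows "a = b \<longleftrightarrow> coord a BE = coord b BE \<and> coord a (BX I1) = coord b (BX I1) \<and>
    coord a (BX I2) = coord b (BX I2) \<and> coord a (BY I1) = coord b (BY I1) \<and>
    coord a (BY I2) = coord b (BY I2) \<and> coord a (BF I1 I1) = coord b (BF I1 I1) \<and>
    coord a (BF I1 I2) = coord b (BF I1 I2) \<and> coord a (BF I2 I1) = coord b (BF I2 I1) \<and>
    coord a (BF I2 I2) = coord b (BF I2 I2)" (is "_ \<longleftrightarrow> ?r")
proof
  assume r: ?r
  show "a = b"
  proof (rule ralg_eqI)
    fix c :: bas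
    have "c \<in> {BE, BX I1, BX I2, BY I1, BY I2, BF I1 I1, BF I1 I2, BF I2 I1, BF I2 I2}"
      using UNIV_bas by blast
    then show "coord a c = coord b c"
      using r by auto
  qed
qed simp

lemma gmul_one_left: "gmul False s 1 a = a"
  by (simp add: ralg_eq_iff gmul_def coord_one)

lemma gmul_one_right: "gmul s False a 1 = a"
  by (simp add: ralg_eq_iff gmul_def coord_one)

lemma gmul_act:
  "gmul False s (a * b) c = gmul False s a (gmul False s b c)"
  "gmul s False c (a * b) = gmul s False (gmul s False c a) b"
  "gmul s False (gmul False s a c) b = gmul False s a (gmul s False c b)"
  using gmul_assoc [of False False s a b c] gmul_assoc [of s False False c a b]
    gmul_assoc [of False s False a c b]
  by simp_all

lemma gmul_pairing:
  "gmul s t (gmul False s a c) d = gmul False (s \<noteq> t) a (gmul s t c d)"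
  "gmul s t c (gmul t False d a) = gmul (s \<noteq> t) False (gmul s t c d) a"
  "gmul s t (gmul s False c a) d = gmul s t c (gmul False t a d)"
  using gmul_assoc [of False s t a c d] gmul_assoc [of s t False c d a] gmul_assoc [of s False t c a d]
  by simp_all

lemma gmul_scalar: "gmul False s (rscale k 1) a = rscale k a" "gmul s False a (rscale k 1) = rscale k a"
  by (simp_all add: gmul_scale gmul_one_left gmul_one_right)

text \<open>\<open>col s i\<close> is entry \<open>i\<close> of a column of homogeneous matrix units and \<open>row s i\<close> of the row inverse
  to it; \<open>E, F\<^sub>1\<^sub>1\<close> are representatives of the primitive idempotents.\<close>

definition col :: "bool \<Rightarrow> nat \<Rightarrow> 'k::field ralg" where
  "col s i = basis_elem ((if s then [BX I1, BY I1, BY I2] else [BE, BF I1 I1, BF I2 I1]) ! i)"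

definition row :: "bool \<Rightarrow> nat \<Rightarrow> 'k::field ralg" where
  "row s i = basis_elem ((if s then [BY I1, BX I1, BX I2] else [BE, BF I1 I1, BF I1 I2]) ! i)"

definition prim :: "bool \<Rightarrow> nat \<Rightarrow> 'k::field ralg" where
  "prim s i = basis_elem (if (i = 0) = s then BF I1 I1 else BE)"

text \<open>\<open>prim s\<close> records the matching: index 0 stands for the block of
  \<open>E\<close>, indices 1 and 2 for the block of the \<open>F_ij\<close>, and the idempotent
  assigned is that of the same block for even s and of the other block for odd s.\<close>

lemma row_col:
  assumes "i \<in> {0, 1, 2}" "j \<in> {0, 1, 2}"
  shows "gmul s s (row s i) (col s j) = (if i = j then prim s i else 0 :: 'k::field ralg)"
  using assms
  by (cases s; elim insertE emptyE) (simp_all add: ralg_eq_iff row_def col_def prim_def gmul_def coord_basis_elem)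

text \<open>Used as a partition of unity: d is the sum of the (d col_i) row_i, where d col_i is even
  when d has degree s.\<close>

lemma col_row: "gmul s s (col s 0) (row s 0) + (gmul s s (col s 1) (row s 1) + gmul s s (col s 2) (row s 2))
    = (1 :: 'k::field ralg)"
  by (cases s) (simp_all add: ralg_eq_iff row_def col_def gmul_def coord_basis_elem coord_one)

lemma prim_row: "i \<in> {0, 1, 2} \<Longrightarrow> gmul False s (prim s i) (row s i) = (row s i :: 'k::field ralg)"
  by (cases s) (auto simp: ralg_eq_iff row_def prim_def gmul_def coord_basis_elem)

section \<open>Graded pieces as bimodules\<close>

text \<open>One family for both shapes of bimodule in the theorem: the twisted regular bimodule in
  even degree (\<open>gbimod_False\<close>), the twisted dual in odd degree
  (\<open>gbimod_True\<close>).\<close>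

definition gbimod :: "bool \<Rightarrow> ('k::field ralg \<Rightarrow> 'k ralg) \<Rightarrow> ('k ralg, 'k ralg) bimod" where
  "gbimod s \<alpha> = \<lparr>carrier = UNIV, monoid.mult = (+), one = 0, lact = gmul False s,
     ract = (\<lambda>v r. gmul s False v (\<alpha> r))\<rparr>"

lemma gbimod_simps [simp]:
  "carrier (gbimod s \<alpha>) = UNIV" "monoid.mult (gbimod s \<alpha>) = (+)" "one (gbimod s \<alpha>) = 0"
  "lact (gbimod s \<alpha>) = gmul False s" "ract (gbimod s \<alpha>) v r = gmul s False v (\<alpha> r)"
  by (simp_all add: gbimod_def)

lemma alg_auts_simps:
  assumes "\<alpha> \<in> alg_auts (rscale :: 'k::field \<Rightarrow> _)"
  shows "\<alpha> (a + b) = \<alpha> a + \<alpha> b" "\<alpha> (a * b) = \<alpha> a * \<alpha> b" "\<alpha> 1 = 1" "\<alpha> (rscale k a) = rscale k (\<alpha> a)"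
    "bij \<alpha>" "\<alpha> 0 = 0"
proof -
  show *: "\<alpha> (a + b) = \<alpha> a + \<alpha> b" "\<alpha> (a * b) = \<alpha> a * \<alpha> b" "\<alpha> 1 = 1"
    "\<alpha> (rscale k a) = rscale k (\<alpha> a)" "bij \<alpha>" for a b k
    using assms unfolding alg_auts_def by (auto simp: Vector_Spaces.linear_iff)
  show "\<alpha> 0 = 0"
    using *(1) [of 0 0] by simp
qed

lemma alg_autsI:
  fixes \<alpha> :: "'k::field ralg \<Rightarrow> 'k ralg"
  assumes "bij \<alpha>" "\<And>a b. \<alpha> (a + b) = \<alpha> a + \<alpha> b" "\<And>a b. \<alpha> (a * b) = \<alpha> a * \<alpha> b" "\<alpha> 1 = 1"
    "\<And>k a. \<alpha> (rscale k a) = rscale k (\<alpha> a)"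
  shows "\<alpha> \<in> alg_auts rscale"
  using assms k_algebra_rscale [where 'a = 'k]
  by (simp add: alg_auts_def Vector_Spaces.linear_iff k_algebra_def)

lemma comm_group_gbimod: "comm_group (gbimod s \<alpha>)"
  by (rule comm_groupI) (auto simp: algebra_simps, metis add.right_inverse)

lemma bimodule_gbimod:
  "\<alpha> \<in> alg_auts (rscale :: 'k::field \<Rightarrow> _) \<Longrightarrow> bimodule rscale (gbimod s \<alpha>)"
  by (intro bimodule.intro comm_group_gbimod bimodule_axioms.intro k_algebra_rscale)
    (simp_all add: gmul_add_left gmul_add_right gmul_act gmul_one_left gmul_one_right gmul_scalar alg_auts_simps)

lemma gbimod_False: "gbimod False \<alpha> = twist_bimod regular_bimod \<alpha>"
  by (simp add: gbimod_def twist_bimod_def regular_bimod_def fun_eq_iff)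

lemma gbimod_False_id: "gbimod False id = regular_bimod"
  by (simp add: gbimod_def regular_bimod_def fun_eq_iff)

section \<open>The dual bimodule\<close>

text \<open>Applied to an odd element, whose diagonal entries are multiples of x, this is the
  coefficient of x in the trace of a 3 x 3 matrix.\<close>

definition gtrace :: "'k::field ralg \<Rightarrow> 'k" where
  "gtrace a = coord a BE + coord a (BF I1 I1) + coord a (BF I2 I2)"

definition dform :: "'k::field ralg \<Rightarrow> 'k ralg \<Rightarrow> 'k" where
  "dform d a = gtrace (gmul True False d a)"

text \<open>For the trace form \<open>E\<close> is dual to itself, \<open>X_j\<close> to
  \<open>Y_j\<close> and \<open>F_ij\<close> to \<open>F_ji\<close>, so each coordinate is read off
  at the dual basis element.\<close>

definition undform :: "('k::field ralg \<Rightarrow> 'k) \<Rightarrow> 'k ralg" where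
  "undform f = RAlg (\<lambda>c. f (basis_elem (case c of BE \<Rightarrow> BE | BX j \<Rightarrow> BY j | BY j \<Rightarrow> BX j | BF i j \<Rightarrow> BF j i)))"

text \<open>Cyclicity of the trace: tr(r d a) = tr(d a r).\<close>

lemma dform_left: "dform (gmul False True r d) a = dform d (a * r)"
  by (simp add: dform_def gtrace_def gmul_def coord_times algebra_simps)

lemma dform_add: "dform (d + d') a = dform d a + dform d' a"
  by (simp add: dform_def gmul_add_left gtrace_def)

lemma dform_right: "dform (gmul True False d r) a = dform d (r * a)"
  unfolding dform_def gmul_act ..

lemma undform_dform: "undform (dform d) = d"
  by (simp add: ralg_eq_iff undform_def dform_def gtrace_def gmul_def coord_basis_elem)

lemma ralg_expand:
  fixes a :: "'k::field ralg"
  shows "a = rscale (coord a BE) (basis_elem BE) +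
    rscale (coord a (BX I1)) (basis_elem (BX I1)) + rscale (coord a (BX I2)) (basis_elem (BX I2)) +
    rscale (coord a (BY I1)) (basis_elem (BY I1)) + rscale (coord a (BY I2)) (basis_elem (BY I2)) +
    rscale (coord a (BF I1 I1)) (basis_elem (BF I1 I1)) + rscale (coord a (BF I1 I2)) (basis_elem (BF I1 I2)) +
    rscale (coord a (BF I2 I1)) (basis_elem (BF I2 I1)) + rscale (coord a (BF I2 I2)) (basis_elem (BF I2 I2))"
  by (simp add: ralg_eq_iff coord_basis_elem)

lemma vector_space_rscale: "vector_space (rscale :: 'k::field \<Rightarrow> _)"
  using k_algebra_rscale k_algebra_def by blast

lemma vector_space_field: "vector_space ((*) :: 'k::field \<Rightarrow> 'k \<Rightarrow> 'k)"
  by unfold_locales (simp_all add: algebra_simps)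

lemma linear_form_iff:
  "Vector_Spaces.linear rscale (*) f \<longleftrightarrow>
     (\<forall>a b. f (a + b) = f a + f b) \<and> (\<forall>k a. f (rscale k a) = (k :: 'k::field) * f a)"
  using vector_space_rscale vector_space_field by (auto simp: Vector_Spaces.linear_iff)

lemma linear_dform: "Vector_Spaces.linear rscale (*) (dform d)"
  unfolding linear_form_iff dform_def
  by (simp add: gmul_add_right gmul_scale gtrace_def algebra_simps)

lemma dform_undform:
  assumes "Vector_Spaces.linear rscale (*) f"
  shows "dform (undform f) = (f :: 'k::field ralg \<Rightarrow> 'k)"
proof
  fix a
  show "dform (undform f) a = f a"
    by (subst (2) ralg_expand [of a])
      (use assms in \<open>simp add: linear_form_iff dform_def gtrace_def gmul_def undform_def algebra_simps\<close>)
qed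

lemma dform_inj: "dform d = dform d' \<Longrightarrow> d = d'"
  by (metis undform_dform)

lemma dual_bimod_simps [simp]:
  "carrier (dual_bimod rscale) = {f. Vector_Spaces.linear rscale (*) f}"
  "monoid.mult (dual_bimod rscale) = (\<lambda>f g a. f a + g a)" "one (dual_bimod rscale) = (\<lambda>_. 0)"
  "lact (dual_bimod rscale) = (\<lambda>r f a. f (a * r))" "ract (dual_bimod rscale) = (\<lambda>f r a. f (r * a))"
  by (simp_all add: dual_bimod_def)

lemma gbimod_True: "gbimod True \<alpha> \<simeq>\<^sub>b twist_bimod (dual_bimod rscale) \<alpha>"
proof -
  have "dform \<in> hom (gbimod True \<alpha>) (twist_bimod (dual_bimod rscale) \<alpha>)"
    by (rule homI) (auto simp: twist_bimod_def linear_dform dform_def gmul_add_left gtrace_def)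
  moreover have "bij_betw dform UNIV {f. Vector_Spaces.linear rscale (*) f}"
    by (rule bij_betw_byWitness [where f' = undform]) (auto simp: undform_dform dform_undform linear_dform)
  ultimately have "dform \<in> iso (gbimod True \<alpha>) (twist_bimod (dual_bimod rscale) \<alpha>)"
    by (simp add: iso_def twist_bimod_def)
  then show ?thesis
    unfolding bimod_iso_def
    by (rule bexI [rotated]) (simp add: twist_bimod_def fun_eq_iff dform_left dform_right)
qed

lemma twist_bimod_id: "twist_bimod V id = V"
  by (simp add: twist_bimod_def)

lemma gbimod_True_id: "gbimod True id \<simeq>\<^sub>b dual_bimod rscale"
  using gbimod_True [of id] by (simp only: twist_bimod_id)

section \<open>Automorphisms\<close>

lemma alg_auts_id: "id \<in> alg_auts (rscale :: 'k::field \<Rightarrow> _)"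
  by (rule alg_autsI) auto

lemma alg_auts_comp:
  "\<alpha> \<in> alg_auts (rscale :: 'k::field \<Rightarrow> _) \<Longrightarrow> \<beta> \<in> alg_auts rscale \<Longrightarrow> \<alpha> \<circ> \<beta> \<in> alg_auts rscale"
  by (rule alg_autsI) (auto simp: alg_auts_simps intro: bij_comp)

lemma alg_auts_inv:
  assumes \<alpha>: "\<alpha> \<in> alg_auts (rscale :: 'k::field \<Rightarrow> _)"
  shows "inv_into UNIV \<alpha> \<in> alg_auts rscale"
proof (rule alg_autsI)
  have b: "bij \<alpha>" and i: "\<alpha> (inv_into UNIV \<alpha> x) = x" "inj \<alpha>" for x
    using alg_auts_simps(5) [OF \<alpha>] by (auto simp: bij_def surj_f_inv_f)
  show "bij (inv_into UNIV \<alpha>)"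
    using b by (rule bij_imp_bij_inv)
  fix a b k
  show "inv_into UNIV \<alpha> (a + b) = inv_into UNIV \<alpha> a + inv_into UNIV \<alpha> b" "inv_into UNIV \<alpha> (a * b) = inv_into UNIV \<alpha> a * inv_into UNIV \<alpha> b"
    "inv_into UNIV \<alpha> 1 = 1" "inv_into UNIV \<alpha> (rscale k a) = rscale k (inv_into UNIV \<alpha> a)"
    by (rule injD [OF i(2)], simp add: i alg_auts_simps [OF \<alpha>])+
qed

lemma group_Aut: "group (Aut_alg (rscale :: 'k::field \<Rightarrow> _))"
proof (rule groupI)
  fix \<alpha> assume "\<alpha> \<in> carrier (Aut_alg (rscale :: 'k \<Rightarrow> _))"
  then show "\<exists>\<beta> \<in> carrier (Aut_alg rscale). \<beta> \<otimes>\<^bsub>Aut_alg rscale\<^esub> \<alpha> = \<one>\<^bsub>Aut_alg rscale\<^esub>"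
    using alg_auts_simps(5) alg_auts_inv
    by (intro bexI [of _ "inv_into UNIV \<alpha>"]) (auto simp: Aut_alg_def bij_def)
qed (auto simp: Aut_alg_def alg_auts_id alg_auts_comp)

text \<open>In odd degree this is the transpose, composing a linear form with the inverse of
  \<alpha>, moved to the odd part by \<open>dform\<close>; the inverse appears because
  precomposition reverses direction. Twisting the dual by \<alpha> on both sides therefore gives the
  dual back, so its class commutes with all twists.\<close>

lemma graded_extension:
  assumes \<alpha>: "\<alpha> \<in> alg_auts (rscale :: 'k::field \<Rightarrow> _)"
  obtains h where "bij h" "\<And>x y. h (x + y) = h x + h y"
    "\<And>r x. h (gmul False s r x) = gmul False s (\<alpha> r) (h x)"
    "\<And>r x. h (gmul s False x r) = gmul s False (h x) (\<alpha> r)"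
proof (cases s)
  case False
  then show ?thesis
    using that [of \<alpha>] alg_auts_simps [OF \<alpha>] by simp
next
  case True
  define h where "h = (\<lambda>\<beta> d. undform (dform d \<circ> \<beta>) :: 'k ralg)"
  have dh: "dform (h \<beta> d) a = dform d (\<beta> a)" if "\<beta> \<in> alg_auts rscale" for \<beta> d a
    unfolding h_def
    by (subst dform_undform)
      (use linear_dform [of d] alg_auts_simps [OF that] in \<open>auto simp: linear_form_iff\<close>)
  have inv: "\<alpha> (inv_into UNIV \<alpha> x) = x" "inv_into UNIV \<alpha> (\<alpha> x) = x" for x
    using alg_auts_simps(5) [OF \<alpha>] by (auto simp: bij_def surj_f_inv_f)
  note \<alpha>' = alg_auts_inv [OF \<alpha>]
  have "h (inv_into UNIV \<alpha>) (h \<alpha> d) = d" "h \<alpha> (h (inv_into UNIV \<alpha>) d) = d" for d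
    by (rule dform_inj, rule ext, simp add: dh \<alpha> \<alpha>' inv)+
  then have "bij (h (inv_into UNIV \<alpha>))"
    by (metis bijI')
  moreover have "h (inv_into UNIV \<alpha>) (x + y) = h (inv_into UNIV \<alpha>) x + h (inv_into UNIV \<alpha>) y" for x y
    by (rule dform_inj, rule ext) (simp add: dh \<alpha>' dform_add)
  moreover have "h (inv_into UNIV \<alpha>) (gmul False True r x) = gmul False True (\<alpha> r) (h (inv_into UNIV \<alpha>) x)" for r x
    by (rule dform_inj, rule ext) (simp add: dh \<alpha>' dform_left alg_auts_simps [OF \<alpha>'] inv)
  moreover have "h (inv_into UNIV \<alpha>) (gmul True False x r) = gmul True False (h (inv_into UNIV \<alpha>) x) (\<alpha> r)" for r x
    by (rule dform_inj, rule ext) (simp add: dh \<alpha>' dform_right alg_auts_simps [OF \<alpha>'] inv)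
  ultimately show ?thesis
    using True by (intro that [of "h (inv_into UNIV \<alpha>)"]) simp_all
qed

section \<open>Tensor products of graded pieces\<close>

lemma gmul_cancel_left:
  "gmul s (s \<noteq> t) a (gmul s t b c) = gmul False t (gmul s s a b) c"
  "gmul s t a (gmul s (s \<noteq> t) b c) = gmul False (s \<noteq> t) (gmul s s a b) c"
  "gmul s False a (gmul s s b c) = gmul False s (gmul s s a b) c"
  using gmul_assoc [of s s t a b c] gmul_assoc [of s s "s \<noteq> t" a b c] gmul_assoc [of s s s a b c]
  by (cases s; cases t; simp)+

lemma gmul_expand:
  "gmul False s (gmul t t (col t 0) (row t 0)) x +
     (gmul False s (gmul t t (col t 1) (row t 1)) x + gmul False s (gmul t t (col t 2) (row t 2)) x) = x"
  unfolding gmul_add_left [symmetric] col_row gmul_one_left ..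

text \<open>The isomorphism is x \<otimes> y \<mapsto> x h(y), where \<open>h\<close> extends
  \<alpha> to degree t; the extension compensates the twist of the first factor and makes the map
  balanced.\<close>

lemma tensor_gbimod:
  assumes \<alpha>: "\<alpha> \<in> alg_auts (rscale :: 'k::field \<Rightarrow> _)" and \<beta>: "\<beta> \<in> alg_auts rscale"
  shows "tensor_bimod (gbimod s \<alpha>) (gbimod t \<beta>) \<simeq>\<^sub>b gbimod (s \<noteq> t) (\<alpha> \<circ> \<beta>)"
proof -
  let ?P = "gbimod s \<alpha>" and ?Q = "gbimod t \<beta>" and ?G = "gbimod (s \<noteq> t) (\<alpha> \<circ> \<beta>)"
  interpret bimodule_pair rscale ?P ?Q
    using \<alpha> \<beta> by (intro bimodule_pairI bimodule_gbimod)
  interpret G: bimodule rscale ?G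
    using \<alpha> \<beta> by (intro bimodule_gbimod alg_auts_comp)
  obtain h where h: "bij h" "\<And>x y. h (x + y) = h x + h y"
    "\<And>r x. h (gmul False t r x) = gmul False t (\<alpha> r) (h x)"
    "\<And>r x. h (gmul t False x r) = gmul t False (h x) (\<alpha> r)"
    using graded_extension [OF \<alpha>] by metis
  let ?g = "inv_into UNIV h" and ?\<alpha>' = "inv_into UNIV \<alpha>"
  have hg: "h (?g x) = x" and gh: "?g (h x) = x" and \<alpha>\<alpha>': "\<alpha> (?\<alpha>' a) = a" for x a
    using h(1) alg_auts_simps(5) [OF \<alpha>] by (auto simp: bij_def surj_f_inv_f)
  have g_add: "?g (x + y) = ?g x + ?g y" for x y
    by (metis h(2) hg gh)
  let ?b = "\<lambda>x y. gmul s t x (h y)" and ?I = "[0, 1, 2 :: nat]"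
  let ?q = "\<lambda>z i. ?g (gmul s (s \<noteq> t) (row s i) z)"
  \<comment> \<open>The candidate inverse sends z to the sum of the col_i \<otimes> g(row_i z), with
    g inverse to \<open>h\<close>; it comes from the partition of unity
    \<open>col_row\<close>.\<close>
  define sec where "sec = (\<lambda>z. gsum T (\<lambda>i. tens ?P ?Q (col s i) (?q z i)) ?I)"
  have tadd: "tens ?P ?Q p (q + q') = tens ?P ?Q p q \<otimes>\<^bsub>T\<^esub> tens ?P ?Q p q'" for p q q'
    using tens_biadditive hom_mult [of "tens ?P ?Q p" ?Q T q q'] by (simp add: biadditive_def)
  have tc: "tens ?P ?Q p q \<in> carrier T" for p q
    using tens_closed [of p q] by simp
  show ?thesis
  proof (rule tensor_isoI [OF G.comm_group_axioms G.lact_hom G.ract_hom, where b = ?b and s = sec])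
    show "biadditive ?P ?Q ?G ?b"
      unfolding biadditive_def by (auto intro!: homI simp: gmul_add_left gmul_add_right h(2))
    show "balanced ?P ?Q ?b"
      unfolding balanced_def by (simp add: gmul_pairing h(3))
    show "sec \<in> hom ?G T"
    proof (rule homI)
      show "sec x \<in> carrier T" for x
        unfolding sec_def by (rule T.gsum_closed) (rule tc)
      show "sec (x \<otimes>\<^bsub>?G\<^esub> y) = sec x \<otimes>\<^bsub>T\<^esub> sec y" for x y
        unfolding sec_def gbimod_simps gmul_add_right g_add tadd by (rule T.gsum_mult) (rule tc)+
    qed
    fix p q
    show "sec (?b p q) = tens ?P ?Q p q"
    proof -
      have "tens ?P ?Q (col s i) (?q (?b p q) i) = tens ?P ?Q (gmul False s (gmul s s (col s i) (row s i)) p) q" for i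
      proof -
        \<comment> \<open>row_i p is even, hence an element of the algebra. Its preimage under
          \<alpha> moves from q to the twisted first factor, where it acts as row_i p.\<close>
        let ?r = "?\<alpha>' (gmul s s (row s i) p)"
        have "?q (?b p q) i = gmul False t ?r q"
          using h(3) [of ?r q] gh [of "gmul False t ?r q"] by (simp only: gmul_cancel_left \<alpha>\<alpha>')
        then have "tens ?P ?Q (col s i) (?q (?b p q) i) = tens ?P ?Q (gmul s False (col s i) (gmul s s (row s i) p)) q"
          using tens_balanced unfolding balanced_def by (metis gbimod_simps(1,4,5) UNIV_I \<alpha>\<alpha>')
        then show ?thesis
          by (simp only: gmul_cancel_left)
      qed
      then have "sec (?b p q) = gsum T (\<lambda>i. tens ?P ?Q (gmul False s (gmul s s (col s i) (row s i)) p) q) ?I"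
        unfolding sec_def by simp
      also have "\<dots> = tens ?P ?Q (gsum ?P (\<lambda>i. gmul False s (gmul s s (col s i) (row s i)) p) ?I) q"
        by (rule hom_gsum [OF P.is_group T.is_group, symmetric]) (use tens_biadditive in \<open>simp_all add: biadditive_def\<close>)
      also have "gsum ?P (\<lambda>i. gmul False s (gmul s s (col s i) (row s i)) p) ?I = p"
        using gmul_expand [of s s p] by simp
      finally show ?thesis .
    qed
  next
    fix z :: "'k ralg"
    let ?t = "\<lambda>i. gmul s t (col s i) (gmul s (s \<noteq> t) (row s i) z)"
    have "gsum ?G (\<lambda>(p, q). ?b p q) (map (\<lambda>i. (col s i, ?q z i)) ?I) = ?t 0 + (?t 1 + ?t 2)"
      by (simp add: hg)
    also have "\<dots> = z"
      unfolding gmul_cancel_left(2) by (rule gmul_expand)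
    finally show "\<exists>xs. set xs \<subseteq> carrier ?P \<times> carrier ?Q \<and> z = gsum ?G (\<lambda>(p, q). ?b p q) xs"
      by (intro exI [of _ "map (\<lambda>i. (col s i, ?q z i)) ?I"]) simp
  qed (simp_all add: gmul_pairing h(4))
qed

section \<open>Classification of the invertible bimodules\<close>

lemma basis_corner:
  "b = BE \<or> b = BF I1 I1 \<Longrightarrow> basis_elem b * r * basis_elem b = rscale (coord r b) (basis_elem b :: 'k::field ralg)"
  by (auto simp: ralg_eq_iff coord_times coord_basis_elem)

text \<open>As all X_i Y_j and Y_i X_j vanish in the algebra, the two-sided ideal generated by one
  primitive idempotent misses the diagonal block of the other; in particular it does not contain
  1.\<close>

lemma coord_corner:
  fixes r r' :: "'k::field ralg"
  shows "coord (r * basis_elem BE * r') (BF I1 I1) = 0" "coord (r * basis_elem (BF I1 I1) * r') BE = 0"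
  by (simp_all add: coord_times coord_basis_elem)

lemma col_prim: "i \<in> {0, 1, 2} \<Longrightarrow> col False i * prim False i = (col False i :: 'k::field ralg)"
  by (auto simp: col_def prim_def basis_elem_mult)

lemma prim_row_False: "i \<in> {0, 1, 2} \<Longrightarrow> prim False i * row False i = (row False i :: 'k::field ralg)"
  using prim_row [of i False] by simp

lemma rscale_one [simp]: "rscale 1 r = r"
  by (simp add: rscale_def)

lemma rscale_eq: "rscale c r = rscale c 1 * (r :: 'k::field ralg)"
  using gmul_scale(1) [of False False c 1 r] by simp

locale ralg_bimodule = bimodule rscale P
  for P :: "('k::field ralg, 'p) bimod" (structure)
begin

abbreviation kmul :: "'k \<Rightarrow> 'p \<Rightarrow> 'p" where "kmul c p \<equiv> lact P (rscale c 1) p"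

lemma lact_rscale: "p \<in> carrier P \<Longrightarrow> lact P (rscale c r) p = kmul c (lact P r p)"
  by (subst rscale_eq) (rule lact_mult)

lemma ract_rscale: "p \<in> carrier P \<Longrightarrow> ract P p (rscale c r) = kmul c (ract P p r)"
  by (subst rscale_eq) (simp add: ract_mult lact_ract flip: central)

lemma kmul_kmul: "p \<in> carrier P \<Longrightarrow> kmul c (kmul d p) = kmul (c * d) p"
  by (simp add: lact_mult [symmetric] flip: rscale_eq)

lemma kmul_fixed:
  assumes p: "p \<in> carrier P" "p \<noteq> \<one>" and d: "kmul d p = p"
  shows "d = 1"
proof (rule ccontr)
  assume "d \<noteq> 1"
  have "rscale d (1 :: 'k ralg) = rscale (d - 1) 1 + 1"
    by (simp add: rscale_def plus_ralg_def one_ralg_def fun_eq_iff)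
  then have "kmul (d - 1) p \<otimes> p = p"
    using d p by (simp add: add_lact lact_one)
  then have "kmul (d - 1) p = \<one>"
    using p(1) by (simp add: lact_closed)
  then have "kmul (inverse (d - 1) * (d - 1)) p = \<one>"
    by (simp add: p flip: kmul_kmul)
  then show False
    using \<open>d \<noteq> 1\<close> p by (simp add: lact_one)
qed

lemma ract_expand:
  assumes p: "p \<in> carrier P"
  shows "gsum P (\<lambda>i. ract P (ract P p (col False i)) (row False i)) [0, 1, 2 :: nat] = p"
proof -
  have "gsum P (\<lambda>i. ract P (ract P p (col False i)) (row False i)) [0, 1, 2 :: nat] =
      ract P p (col False 0 * row False 0 + (col False 1 * row False 1 + col False 2 * row False 2))"
    using p by (simp add: ract_mult ract_closed add_ract)
  then show ?thesis
    using col_row [of False, where 'k = 'k] p by (simp add: ract_one)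
qed

end

text \<open>Only four consequences of invertibility are kept, so that the inverse bimodule and the
  type of its carrier disappear from the classification.\<close>

locale invertible_ralg_bimodule = ralg_bimodule P
  for P :: "('k::field ralg, 'p) bimod" (structure) +
  assumes dual_basis: "\<exists>L. set L \<subseteq> llin P regular_bimod \<times> carrier P \<and>
      (\<forall>p \<in> carrier P. p = gsum P (\<lambda>(f, x). lact P (f p) x) L)"
    and generator: "\<exists>L. set L \<subseteq> llin P regular_bimod \<times> carrier P \<and> (\<Sum>(f, x)\<leftarrow>L. f x) = 1"
    and llin_ract: "h \<in> llin P P \<Longrightarrow> \<exists>r. \<forall>p \<in> carrier P. h p = ract P p r"
    and ract_faithful: "(\<forall>p \<in> carrier P. ract P p r = \<one>) \<Longrightarrow> r = 0"
begin

text \<open>For a primitive idempotent \<open>e'\<close> the module \<open>P e'\<close> is isomorphic to \<open>R e\<close> for a primitive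
  idempotent \<open>e\<close>: endomorphisms of \<open>P e'\<close> are right multiplications by \<open>e' R e' = K e'\<close>, so
  among the maps \<open>m \<mapsto> f(m) e x\<close> that make up the identity there is a nonzero scalar one.\<close>

lemma corner:
  assumes b': "b' = BE \<or> b' = BF I1 I1"
  defines "e' \<equiv> basis_elem b'"
  obtains b z \<mu> where "b = BE \<or> b = BF I1 I1" "z \<in> carrier P" "lact P (basis_elem b) z = z" "ract P z e' = z"
    "\<mu> \<in> llin P regular_bimod" "\<And>p. p \<in> carrier P \<Longrightarrow> ract P p e' = p \<Longrightarrow> lact P (\<mu> p) z = p"
    "\<And>p. p \<in> carrier P \<Longrightarrow> \<mu> p * basis_elem b = \<mu> p" "\<mu> z = basis_elem b"
proof -
  have e'e': "e' * e' = e'"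
    using b' by (auto simp: e'_def basis_elem_mult)
  have ee: "ract P (ract P p e') e' = ract P p e'" if "p \<in> carrier P" for p
    using that e'e' by (simp flip: ract_mult)
  obtain L where L: "set L \<subseteq> llin P regular_bimod \<times> carrier P"
    "\<And>p. p \<in> carrier P \<Longrightarrow> p = gsum P (\<lambda>(f, x). lact P (f p) x) L"
    using dual_basis by blast
  \<comment> \<open>Inserting 1 as the sum of the col_i row_i into the dual basis splits p \<mapsto>
    p e' into these left-linear maps; the i-th ones factor through the left ideal generated by
    \<open>prim False i\<close>.\<close>
  define h where "h = (\<lambda>f x i p. lact P (f (ract P p e') * col False i) (ract P (lact P (row False i) x) e'))"
  have ra: "f (ract P (m \<otimes> n) e') = f (ract P m e') + f (ract P n e')"
    and rl: "f (ract P (lact P r m) e') = r * f (ract P m e')"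
    if "f \<in> llin P regular_bimod" "m \<in> carrier P" "n \<in> carrier P" for f m n r
    using that llin_add [of f P regular_bimod] llin_lact [of f P regular_bimod]
    by (simp_all add: ract_add ract_closed lact_ract)
  have h_scalar: "\<exists>c. \<forall>p \<in> carrier P. h f x i p = kmul c (ract P p e')"
    if fx: "(f, x) \<in> set L" and i: "i \<in> {0, 1, 2}" for f x i
  proof -
    have f: "f \<in> llin P regular_bimod" and x: "x \<in> carrier P"
      using fx L(1) by auto
    have z: "ract P (lact P (row False i) x) e' \<in> carrier P"
      using x by (simp add: lact_closed ract_closed)
    have "h f x i \<in> llin P P"
      by (rule llinI) (use z in \<open>simp_all add: h_def lact_closed ra rl f distrib_right add_lact lact_mult mult.assoc\<close>)
    then obtain r where r: "\<And>p. p \<in> carrier P \<Longrightarrow> h f x i p = ract P p r"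
      using llin_ract by blast
    have "h f x i p = kmul (coord r b') (ract P p e')" if p: "p \<in> carrier P" for p
    proof -
      \<comment> \<open>The map depends only on p e' and has values in P e', so right multiplication
        by r may be replaced by that by e' r e', a scalar multiple of e'.\<close>
      have "h f x i p = ract P (h f x i (ract P p e')) e'"
        using p x by (simp add: h_def lact_ract ract_closed lact_closed ee)
      also have "\<dots> = ract P p (e' * r * e')"
        using p r by (simp add: ract_mult ract_closed)
      also have "\<dots> = kmul (coord r b') (ract P p e')"
        using b' p by (simp add: e'_def basis_corner ract_rscale)
      finally show ?thesis .
    qed
    then show ?thesis by blast
  qed
  \<comment> \<open>If every component vanished, so would their sum p \<mapsto> p e', contradicting
    faithfulness.\<close>
  have "\<exists>f x i p. (f, x) \<in> set L \<and> i \<in> {0, 1, 2} \<and> p \<in> carrier P \<and> h f x i p \<noteq> \<one>"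
  proof (rule ccontr)
    assume "\<not> ?thesis"
    then have h1: "h f x i p = \<one>" if "(f, x) \<in> set L" "i \<in> {0, 1, 2}" "p \<in> carrier P" for f x i p
      using that by blast
    have "ract P p e' = \<one>" if p: "p \<in> carrier P" for p
    proof -
      have "ract P (ract P p e') e' = ract P (gsum P (\<lambda>(f, x). lact P (f (ract P p e')) x) L) e'"
        using L(2) [OF ract_closed [OF p]] by simp
      also have "\<dots> = gsum P (\<lambda>u. ract P (case u of (f, x) \<Rightarrow> lact P (f (ract P p e')) x) e') L"
        by (rule hom_gsum [OF is_group is_group ract_hom]) (use L(1) in \<open>auto simp: lact_closed\<close>)
      also have "\<dots> = \<one>"
      proof (rule gsum_one)
        fix u assume u: "u \<in> set L"
        obtain f x where fx: "u = (f, x)" by fastforce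
        then have x: "x \<in> carrier P" using u L(1) by auto
        let ?r = "f (ract P p e')" and ?y = "ract P x e'"
        have "lact P ?r ?y = lact P (?r * (col False 0 * row False 0 + (col False 1 * row False 1 + col False 2 * row False 2))) ?y"
          using col_row [of False, where 'k = 'k] by simp
        also have "\<dots> = h f x 0 p \<otimes> (h f x 1 p \<otimes> h f x 2 p)"
          using x by (simp add: h_def distrib_left add_lact ract_closed lact_ract lact_closed lact_mult mult.assoc [symmetric])
        finally show "ract P (case u of (f, x) \<Rightarrow> lact P (f (ract P p e')) x) e' = \<one>"
          using x h1 [of f x] u p by (simp add: fx lact_ract)
      qed
      finally show ?thesis
        using ee [OF p] by simp
    qed
    then have "e' = 0"
      using ract_faithful by blast
    then show False
      using coord_basis_elem [of b' b', where 'k = 'k] by (simp add: e'_def)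
  qed
  then obtain f x i p where fx: "(f, x) \<in> set L" and i: "i \<in> {0, 1, 2 :: nat}" and p: "p \<in> carrier P"
    and ne: "h f x i p \<noteq> \<one>"
    by blast
  obtain c where c: "\<And>p. p \<in> carrier P \<Longrightarrow> h f x i p = kmul c (ract P p e')"
    using h_scalar [OF fx i] by blast
  have c0: "c \<noteq> 0"
  proof
    assume "c = 0"
    moreover have "rscale 0 (1 :: 'k ralg) = 0" by (simp add: rscale_def zero_ralg_def)
    ultimately show False using c [OF p] ne p by (simp add: ract_closed)
  qed
  have f: "f \<in> llin P regular_bimod" and x: "x \<in> carrier P"
    using fx L(1) by auto
  define b where "b = (if i = 0 then BE else BF I1 I1)"
  have e: "basis_elem b = prim False i"
    by (simp add: b_def prim_def)
  \<comment> \<open>The chosen component is c times p \<mapsto> p e'. Splitting it at e =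
    \<open>prim False i\<close> and dividing by c gives the mutually inverse maps p \<mapsto> \<mu>
    p and r \<mapsto> r z between P e' and R e.\<close>
  define z where "z = ract P (lact P (row False i) x) e'"
  define \<mu> where "\<mu> = (\<lambda>p. rscale (inverse c) (f (ract P p e') * col False i))"
  have z: "z \<in> carrier P" "ract P z e' = z"
    using x ee by (simp_all add: z_def lact_closed ract_closed)
  have ez: "lact P (basis_elem b) z = z"
    using i x by (simp add: e z_def lact_ract lact_closed ract_closed prim_row_False flip: lact_mult)
  have rs: "rscale d (r + r') = rscale d r + rscale d r'" "rscale d (r * r') = r * rscale d r'"
    "rscale d r * r' = rscale d (r * r')" for d :: 'k and r r' :: "'k ralg"
    by (auto simp: ralg_eq_iff coord_times algebra_simps)
  have \<mu>: "\<mu> \<in> llin P regular_bimod"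
    by (rule llinI) (simp_all add: \<mu>_def ra rl f distrib_right mult.assoc rs(1,2))
  have \<mu>z: "lact P (\<mu> q) z = q" if q: "q \<in> carrier P" "ract P q e' = q" for q
  proof -
    have "lact P (\<mu> q) z = kmul (inverse c) (h f x i q)"
      using z by (simp add: \<mu>_def h_def z_def lact_rscale)
    also have "\<dots> = kmul (inverse c * c) q"
      using c [OF q(1)] q by (simp add: kmul_kmul)
    finally show ?thesis
      using c0 q(1) by (simp add: lact_one)
  qed
  have \<mu>e: "\<mu> q * basis_elem b = \<mu> q" for q
    using col_prim [OF i, where 'k = 'k] by (simp add: \<mu>_def e rs(3) mult.assoc)
  \<comment> \<open>\<mu> z lies in e R e = K e, and \<mu>(z) z = z with z nonzero forces the scalar
    to be 1.\<close>
  have "\<mu> z = basis_elem b * \<mu> z * basis_elem b"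
    using llin_lact [OF \<mu> z(1), of "basis_elem b"] by (simp add: ez mult.assoc \<mu>e)
  also have "\<dots> = rscale (coord (\<mu> z) b) (basis_elem b)"
    by (rule basis_corner) (simp add: b_def)
  finally have \<mu>zz: "\<mu> z = rscale (coord (\<mu> z) b) (basis_elem b)" .
  then have "kmul (coord (\<mu> z) b) z = z"
    using \<mu>z [OF z] z(1) ez lact_rscale [OF z(1)] by metis
  moreover have "z \<noteq> \<one>"
  proof
    assume "z = \<one>"
    then have "h f x i p = \<one>"
      by (simp add: h_def flip: z_def)
    with ne show False ..
  qed
  ultimately have "coord (\<mu> z) b = 1"
    using kmul_fixed [OF z(1)] by blast
  then have "\<mu> z = basis_elem b"
    using \<mu>zz by simp
  then show ?thesis
    using that [of b z \<mu>] z ez \<mu> \<mu>z \<mu>e by (auto simp: b_def)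
qed

text \<open>The idempotents found for \<open>E\<close> and \<open>F_11\<close> differ, since
  otherwise all values of functionals on P would lie in a proper ideal and P would not be a
  generator; one Boolean s then records the matching. Indices 1 and 2 share the data of
  \<open>F_11\<close>.\<close>

lemma corners:
  obtains s z \<mu> where
    "\<And>i. i \<in> {0, 1, 2 :: nat} \<Longrightarrow> z i \<in> carrier P \<and> lact P (prim s i) (z i) = z i \<and>
      ract P (z i) (prim False i) = z i \<and> \<mu> i \<in> llin P regular_bimod \<and> \<mu> i (z i) = prim s i \<and>
      (\<forall>p \<in> carrier P. \<mu> i p * prim s i = \<mu> i p \<and>
        lact P (\<mu> i (ract P p (col False i))) (z i) = ract P p (col False i))"
proof -
  obtain b1 z1 \<mu>1 where 1: "b1 = BE \<or> b1 = BF I1 I1" "z1 \<in> carrier P" "lact P (basis_elem b1) z1 = z1"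
    "ract P z1 (basis_elem BE) = z1" "\<mu>1 \<in> llin P regular_bimod"
    "\<And>p. p \<in> carrier P \<Longrightarrow> ract P p (basis_elem BE) = p \<Longrightarrow> lact P (\<mu>1 p) z1 = p"
    "\<And>p. p \<in> carrier P \<Longrightarrow> \<mu>1 p * basis_elem b1 = \<mu>1 p" "\<mu>1 z1 = basis_elem b1"
    using corner [of BE] by blast
  obtain b2 z2 \<mu>2 where 2: "b2 = BE \<or> b2 = BF I1 I1" "z2 \<in> carrier P" "lact P (basis_elem b2) z2 = z2"
    "ract P z2 (basis_elem (BF I1 I1)) = z2" "\<mu>2 \<in> llin P regular_bimod"
    "\<And>p. p \<in> carrier P \<Longrightarrow> ract P p (basis_elem (BF I1 I1)) = p \<Longrightarrow> lact P (\<mu>2 p) z2 = p"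
    "\<And>p. p \<in> carrier P \<Longrightarrow> \<mu>2 p * basis_elem b2 = \<mu>2 p" "\<mu>2 z2 = basis_elem b2"
    using corner [of "BF I1 I1"] by blast
  define z where "z = (\<lambda>i :: nat. if i = 0 then z1 else z2)"
  define \<mu> where "\<mu> = (\<lambda>i :: nat. if i = 0 then \<mu>1 else \<mu>2)"
  define e :: "nat \<Rightarrow> 'k ralg" where "e = (\<lambda>i. if i = 0 then basis_elem b1 else basis_elem b2)"
  have p0: "prim False 0 = basis_elem BE" "i \<noteq> 0 \<Longrightarrow> prim False i = basis_elem (BF I1 I1)" for i
    by (simp_all add: prim_def)
  have cp: "ract P (ract P p (col False i)) (prim False i) = ract P p (col False i)"
    if "p \<in> carrier P" "i \<in> {0, 1, 2}" for p i
    using that by (simp add: col_prim flip: ract_mult)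
  have A: "z i \<in> carrier P \<and> lact P (e i) (z i) = z i \<and>
      ract P (z i) (prim False i) = z i \<and> \<mu> i \<in> llin P regular_bimod \<and> \<mu> i (z i) = e i \<and>
      (\<forall>p \<in> carrier P. \<mu> i p * e i = \<mu> i p \<and>
        lact P (\<mu> i (ract P p (col False i))) (z i) = ract P p (col False i))"
    if i: "i \<in> {0, 1, 2}" for i
  proof (cases "i = 0")
    case True
    show ?thesis
      using 1(2-5,7,8) 1(6) [OF ract_closed] cp [OF _ i]
      by (simp add: True z_def e_def \<mu>_def p0)
  next
    case False
    show ?thesis
      using 2(2-5,7,8) 2(6) [OF ract_closed] cp [OF _ i]
      by (simp add: False z_def e_def \<mu>_def p0)
  qed
  have "b1 \<noteq> b2"
  proof
    assume eq: "b1 = b2"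
    \<comment> \<open>The coordinate that vanishes on the ideal generated by
      \<open>basis_elem b1\<close> but is 1 at the unit.\<close>
    define c where "c = (if b1 = BE then BF I1 I1 else BE)"
    have c: "coord (r * basis_elem b1 * r') c = 0" for r r' :: "'k ralg"
      using 1(1) by (auto simp: c_def coord_corner)
    have eb: "e i = basis_elem b1" for i
      by (simp add: e_def eq)
    have fx: "coord (f x) c = 0" if f: "f \<in> llin P regular_bimod" and x: "x \<in> carrier P" for f x
    proof -
      have t: "coord (f (ract P (ract P x (col False i)) (row False i))) c = 0" if i: "i \<in> {0, 1, 2}" for i
      proof -
        let ?\<nu> = "\<mu> i (ract P x (col False i))"
        have zi: "z i \<in> carrier P" "lact P (basis_elem b1) (z i) = z i"
            "lact P ?\<nu> (z i) = ract P x (col False i)"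
          using A [OF i] x by (simp_all add: eb)
        have "ract P (ract P x (col False i)) (row False i) =
            lact P (?\<nu> * basis_elem b1) (ract P (z i) (row False i))"
          using zi by (simp add: lact_mult lact_ract [symmetric] lact_closed ract_closed)
        then have "f (ract P (ract P x (col False i)) (row False i)) =
            ?\<nu> * basis_elem b1 * f (ract P (z i) (row False i))"
          using llin_lact [OF f ract_closed [OF zi(1)]] by simp
        then show ?thesis by (simp add: c)
      qed
      let ?g = "\<lambda>i. ract P (ract P x (col False i)) (row False i)"
      have "f x = f (gsum P ?g [0, 1, 2])"
        using ract_expand [OF x] by simp
      also have "\<dots> = gsum regular_bimod (\<lambda>i. f (?g i)) [0, 1, 2]"
        by (rule hom_gsum [OF is_group group_regular llin_hom [OF f]]) (simp add: x ract_closed)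
      finally show ?thesis
        using t by simp
    qed
    obtain L where L: "set L \<subseteq> llin P regular_bimod \<times> carrier P" "(\<Sum>(f, x)\<leftarrow>L. f x) = 1"
      using generator by blast
    have "coord (\<Sum>(f, x)\<leftarrow>L. f x) c = 0"
      using L(1) by (induction L) (auto simp: fx)
    then show False
      using L(2) by (simp add: coord_one c_def split: if_splits)
  qed
  then have "e i = prim (b1 \<noteq> BE) i" for i
    using 1(1) 2(1) by (auto simp: e_def prim_def)
  then show ?thesis
    using that [of z "b1 \<noteq> BE" \<mu>] A by simp
qed

text \<open>p is recovered from its parts p col_i. Each part lies in a copy of the left ideal
  generated by \<open>prim s i\<close>, and multiplying by \<open>row s i\<close> places it in the
  piece of degree s. For odd s this gives one copy of R F_11 and two of R E, the left-module
  structure of the dual.\<close>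

lemma left_iso:
  obtains s g k where "g \<in> llin (gbimod s id) P" "k \<in> llin P (gbimod s id)"
    "\<And>d. k (g d) = d" "\<And>p. p \<in> carrier P \<Longrightarrow> g (k p) = p"
proof -
  obtain s z \<mu> where A:
    "\<And>i. i \<in> {0, 1, 2 :: nat} \<Longrightarrow> z i \<in> carrier P \<and> lact P (prim s i) (z i) = z i \<and>
      ract P (z i) (prim False i) = z i \<and> \<mu> i \<in> llin P regular_bimod \<and> \<mu> i (z i) = prim s i \<and>
      (\<forall>p \<in> carrier P. \<mu> i p * prim s i = \<mu> i p \<and>
        lact P (\<mu> i (ract P p (col False i))) (z i) = ract P p (col False i))"
    by (rule corners) blast
  let ?M = "gbimod s id" and ?I = "[0, 1, 2 :: nat]"
  define k where "k = (\<lambda>p. gsum ?M (\<lambda>i. gmul False s (\<mu> i (ract P p (col False i))) (row s i)) ?I)"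
  define g where "g = (\<lambda>d. gsum P (\<lambda>i. ract P (lact P (gmul s s d (col s i)) (z i)) (row False i)) ?I)"
  interpret M: bimodule rscale ?M
    by (rule bimodule_gbimod [OF alg_auts_id])
  have I: "i \<in> {0, 1, 2}" if "i \<in> set ?I" for i
    using that by simp
  have zc: "z i \<in> carrier P" if "i \<in> set ?I" for i
    using A [OF I [OF that]] by blast
  have \<mu>l: "\<mu> i \<in> llin P regular_bimod" if "i \<in> set ?I" for i
    using A [OF I [OF that]] by blast
  have c: "ract P (lact P r (z i)) r' \<in> carrier P" if "i \<in> set ?I" for i r r'
    using zc [OF that] by (simp add: lact_closed ract_closed)
  have g: "g \<in> llin ?M P"
  proof (rule llinI)
    show "g d \<in> carrier P" for d
      unfolding g_def by (rule gsum_closed) (rule c)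
    show "g (d \<otimes>\<^bsub>?M\<^esub> d') = g d \<otimes> g d'" for d d'
    proof -
      have "g (d \<otimes>\<^bsub>?M\<^esub> d') = gsum P (\<lambda>i. ract P (lact P (gmul s s d (col s i)) (z i)) (row False i) \<otimes>
          ract P (lact P (gmul s s d' (col s i)) (z i)) (row False i)) ?I"
        unfolding g_def
        by (rule gsum_cong) (use zc in \<open>simp add: gmul_add_left add_lact ract_add lact_closed\<close>)
      also have "\<dots> = g d \<otimes> g d'"
        unfolding g_def by (rule gsum_mult) (rule c, assumption)+
      finally show ?thesis .
    qed
    show "g (lact ?M r d) = lact P r (g d)" for r d
    proof -
      have "lact P r (g d) = gsum P (\<lambda>i. lact P r (ract P (lact P (gmul s s d (col s i)) (z i)) (row False i))) ?I"
        unfolding g_def by (rule hom_gsum [OF is_group is_group lact_hom]) (rule c)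
      also have "\<dots> = g (lact ?M r d)"
        unfolding g_def
        by (rule gsum_cong) (use zc in \<open>simp add: gmul_pairing lact_mult lact_ract [symmetric] lact_closed\<close>)
      finally show ?thesis ..
    qed
  qed
  have k: "k \<in> llin P ?M"
    by (rule llinI)
      (use llin_add [OF \<mu>l] llin_lact [OF \<mu>l] in
        \<open>simp_all add: k_def ract_add ract_closed lact_ract gmul_add_left gmul_add_right gmul_act\<close>)
  have kg: "k (g d) = d" for d
  proof -
    have t: "gmul False s (\<mu> i (ract P (g d) (col False i))) (row s i) = gmul False s d' (row s i)"
      if i: "i \<in> set ?I" and d': "d' = gmul s s d (col s i)" for i d'
    proof -
      let ?w = "\<lambda>j. ract P (lact P (gmul s s d (col s j)) (z j)) (row False j)"
      have "ract P (g d) (col False i) = gsum P (\<lambda>j. ract P (?w j) (col False i)) ?I"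
        unfolding g_def by (rule hom_gsum [OF is_group is_group ract_hom]) (rule c)
      \<comment> \<open>By orthogonality of rows and columns only the summand j = i
        survives.\<close>
      also have "\<dots> = gsum P (\<lambda>j. if j = i then lact P d' (z i) else \<one>) ?I"
      proof (rule gsum_cong)
        fix j assume j: "j \<in> set ?I"
        have "ract P (?w j) (col False i) = ract P (lact P (gmul s s d (col s j)) (z j)) (row False j * col False i)"
          using zc [OF j] by (simp add: ract_mult lact_closed)
        also have "row False j * col False i = (if j = i then prim False i else (0 :: 'k ralg))"
          using row_col [OF I [OF j] I [OF i], of False, where 'k = 'k] by auto
        also have "ract P (lact P (gmul s s d (col s j)) (z j)) (if j = i then prim False i else 0) =
            (if j = i then lact P d' (z i) else \<one>)"
          using zc [OF j] A [OF I [OF j]] d' by (auto simp: lact_closed lact_ract)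
        finally show "ract P (?w j) (col False i) = (if j = i then lact P d' (z i) else \<one>)" .
      qed
      also have "\<dots> = lact P d' (z i)"
        using i zc [OF i] by (auto simp: lact_closed)
      finally have "\<mu> i (ract P (g d) (col False i)) = d' * prim s i"
        using A [OF I [OF i]] llin_lact [OF \<mu>l [OF i] zc [OF i]] by simp
      then show ?thesis
        using prim_row [OF I [OF i], of s, where 'k = 'k] by (simp only: gmul_act)
    qed
    have "k (g d) = gsum ?M (\<lambda>i. gmul s False d (gmul s s (col s i) (row s i))) ?I"
      unfolding k_def
      by (rule gsum_cong, subst t [OF _ refl])
        (use gmul_assoc [of s s s d] in simp_all)
    also have "\<dots> = gmul s False d 1"
      unfolding col_row [of s, symmetric] by (simp add: gmul_add_right)
    finally show ?thesis
      by (simp add: gmul_one_right)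
  qed
  have gk: "g (k p) = p" if p: "p \<in> carrier P" for p
  proof -
    have t: "gmul s s (k p) (col s i) = \<mu> i (ract P p (col False i))" if i: "i \<in> set ?I" for i
    proof -
      have "gmul s s (k p) (col s i) =
          gsum regular_bimod (\<lambda>j. gmul s s (gmul False s (\<mu> j (ract P p (col False j))) (row s j)) (col s i)) ?I"
        by (simp add: k_def gmul_add_left)
      also have "\<dots> = gsum regular_bimod (\<lambda>j. if j = i then \<mu> i (ract P p (col False i)) else 0) ?I"
      proof (rule gsum_cong)
        fix j assume j: "j \<in> set ?I"
        show "gmul s s (gmul False s (\<mu> j (ract P p (col False j))) (row s j)) (col s i) =
            (if j = i then \<mu> i (ract P p (col False i)) else 0)"
          using row_col [OF I [OF j] I [OF i], of s, where 'k = 'k] A [OF I [OF j]] ract_closed [OF p]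
          by (cases "j = i") (simp_all add: gmul_pairing)
      qed
      also have "\<dots> = \<mu> i (ract P p (col False i))"
        using i by auto
      finally show ?thesis .
    qed
    have "g (k p) = gsum P (\<lambda>i. ract P (ract P p (col False i)) (row False i)) ?I"
      unfolding g_def by (rule gsum_cong) (use t A p in simp)
    then show ?thesis
      using ract_expand [OF p] by simp
  qed
  show ?thesis
    using that [OF g k kg gk] .
qed

text \<open>Take d = row_i and multiply by col_i from the left; summing over i gives 1 a = 1
  b.\<close>

lemma gmul_faithful:
  assumes "\<And>d. gmul s False d a = gmul s False d b"
  shows "a = (b :: 'k ralg)"
proof -
  have "gmul s s c (gmul s False d a) = gmul False False (gmul s s c d) a" for c d a :: "'k ralg"
    using gmul_assoc [of s s False c d a] by simp
  then have "gmul s s c d * a = gmul s s c d * b" for c d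
    using assms by (metis gmul_False)
  then have "1 * a = 1 * b"
    unfolding col_row [of s, symmetric] distrib_right by simp
  then show ?thesis by simp
qed

text \<open>Carried over to the piece of degree s, the right action of r on P is a left-linear
  endomorphism, hence right multiplication by some \<alpha>(r). Faithfulness of P makes \<alpha>
  injective and \<open>llin_ract\<close> makes it surjective.\<close>

lemma iso_gbimod:
  obtains s \<alpha> where "\<alpha> \<in> alg_auts rscale" "P \<simeq>\<^sub>b gbimod s \<alpha>"
proof -
  obtain s g k where g: "g \<in> llin (gbimod s id) P" and k: "k \<in> llin P (gbimod s id)"
    and kg: "\<And>d. k (g d) = d" and gk: "\<And>p. p \<in> carrier P \<Longrightarrow> g (k p) = p"
    by (rule left_iso) (rule that)
  \<comment> \<open>The image of 1 as the sum of the col_i row_i: the unit itself lies only in the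
    even part, but the row_i lie in the piece of degree s.\<close>
  define \<alpha> where "\<alpha> = (\<lambda>r. \<Sum>i\<leftarrow>[0, 1, 2]. gmul s s (col s i) (k (ract P (g (row s i)) r)))"
  have gc: "g d \<in> carrier P" for d
    using llin_closed [OF g] by simp
  have ga: "g (d + d') = g d \<otimes> g d'" and gl: "g (gmul False s r d) = lact P r (g d)" for d d' r
    using llin_add [OF g] llin_lact [OF g] by simp_all
  have ka: "k (p \<otimes> q) = k p + k q" if "p \<in> carrier P" "q \<in> carrier P" for p q
    using that llin_add [OF k] by simp
  have kl: "k (lact P r p) = gmul False s r (k p)" if "p \<in> carrier P" for p r
    using that llin_lact [OF k] by simp
  have char: "k (ract P (g d) r) = gmul s False d (\<alpha> r)" for d r
  proof -
    let ?h = "\<lambda>d. k (ract P (g d) r)"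
    have h: "?h (d + d') = ?h d + ?h d'" "?h (gmul False s a d) = gmul False s a (?h d)" for d d' a
      using gc by (simp_all add: ga gl ract_add lact_ract ka kl ract_closed)
    have "gmul s False d (\<alpha> r) = ?h (gmul False s (gmul s s d (col s 0)) (row s 0) +
        (gmul False s (gmul s s d (col s 1)) (row s 1) + gmul False s (gmul s s d (col s 2)) (row s 2)))"
      by (simp add: \<alpha>_def h gmul_add_right gmul_cancel_left)
    also have "gmul False s (gmul s s d (col s 0)) (row s 0) +
        (gmul False s (gmul s s d (col s 1)) (row s 1) + gmul False s (gmul s s d (col s 2)) (row s 2)) = d"
      unfolding gmul_cancel_left(3) [symmetric] gmul_add_right [symmetric] col_row by (rule gmul_one_right)
    finally show ?thesis ..
  qed
  have \<alpha>_eqI: "\<alpha> r = a" if "\<And>d. k (ract P (g d) r) = gmul s False d a" for r a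
    by (rule gmul_faithful [of s]) (use that char in simp)
  have gchar: "ract P (g d) r = g (gmul s False d (\<alpha> r))" for d r
    using gk [OF ract_closed [OF gc]] char by metis
  have add: "\<alpha> (r + r') = \<alpha> r + \<alpha> r'" for r r'
    by (rule \<alpha>_eqI) (simp add: add_ract gc ka ract_closed char gmul_add_right)
  have "inj \<alpha>"
  proof (rule injI)
    fix r r' assume eq: "\<alpha> r = \<alpha> r'"
    have "\<alpha> (r - r') = 0"
      using add [of "r - r'" r'] eq by simp
    then have "ract P (g d) (r - r') = \<one>" for d
      using gchar [of d "r - r'"] gl [of 0 0] gc by simp
    then have "ract P p (r - r') = \<one>" if "p \<in> carrier P" for p
      using gk [OF that] by metis
    then show "r = r'"
      using ract_faithful [of "r - r'"] by simp
  qed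
  moreover have "\<exists>r. a = \<alpha> r" for a
  proof -
    \<comment> \<open>Right multiplication by a, transported back to P, is left linear and therefore
      the right action of some r.\<close>
    have "(\<lambda>p. g (gmul s False (k p) a)) \<in> llin P P"
      by (rule llinI) (simp_all add: gc ka kl gmul_add_left ga gmul_act gl)
    then obtain r where r: "\<And>p. p \<in> carrier P \<Longrightarrow> g (gmul s False (k p) a) = ract P p r"
      using llin_ract by blast
    have "\<alpha> r = a"
      by (rule \<alpha>_eqI) (use r [OF gc] kg in metis)
    then show "\<exists>r. a = \<alpha> r" by blast
  qed
  ultimately have "bij \<alpha>"
    by (simp add: bij_def surj_def)
  have \<alpha>: "\<alpha> \<in> alg_auts rscale"
  proof (rule alg_autsI [OF \<open>bij \<alpha>\<close> add])
    show "\<alpha> (r * r') = \<alpha> r * \<alpha> r'" for r r'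
      by (rule \<alpha>_eqI) (simp add: ract_mult gc gmul_act char gchar [of _ r])
    show "\<alpha> 1 = 1"
      by (rule \<alpha>_eqI) (simp add: ract_one gc kg gmul_one_right)
    \<comment> \<open>Here the centrality of the action of K on P enters, through
      \<open>ract_rscale\<close>.\<close>
    show "\<alpha> (rscale c r) = rscale c (\<alpha> r)" for c r
      by (rule \<alpha>_eqI) (simp add: ract_rscale gc kl ract_closed char gmul_one_left gmul_scalar gmul_scale)
  qed
  have "k \<in> iso P (gbimod s \<alpha>)"
  proof -
    have "k \<in> hom P (gbimod s \<alpha>)"
      by (rule homI) (simp_all add: ka)
    moreover have "bij_betw k (carrier P) UNIV"
      by (rule bij_betw_byWitness [where f' = g]) (auto simp: kg gk gc)
    ultimately show ?thesis
      by (simp add: iso_def)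
  qed
  moreover have "k (ract P p r) = gmul s False (k p) (\<alpha> r)" if "p \<in> carrier P" for p r
    using char [of "k p" r] gk [OF that] by simp
  ultimately have "P \<simeq>\<^sub>b gbimod s \<alpha>"
    unfolding bimod_iso_def by (intro bexI [of _ k]) (simp_all add: kl)
  then show ?thesis
    using that \<alpha> by blast
qed

end

lemma invertible_iso_gbimod:
  fixes P :: "('k::field ralg, 'p) bimod"
  assumes "invertible_bimod TYPE('q) rscale P"
  obtains s \<alpha> where "\<alpha> \<in> alg_auts rscale" "P \<simeq>\<^sub>b gbimod s \<alpha>"
proof -
  have "bimodule rscale P"
    using assms by (simp add: invertible_bimod_def)
  then interpret invertible_ralg_bimodule P
    using invertible_bimod_progenerator [OF assms]
    by (intro invertible_ralg_bimodule.intro ralg_bimodule.intro invertible_ralg_bimodule_axioms.intro)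
  show ?thesis
    using iso_gbimod that .
qed

section \<open>The Picard group\<close>

definition pclass :: "bool \<Rightarrow> ('k::field ralg \<Rightarrow> 'k ralg) \<Rightarrow> 'k ralg small_bimod set" where
  "pclass s \<alpha> = bimod_class rscale (gbimod s \<alpha>)"

lemma bimod_class_eqI:
  assumes "M \<simeq>\<^sub>b N" "N \<simeq>\<^sub>b M"
  shows "bimod_class scale M = bimod_class scale N"
  unfolding bimod_class_def using assms by (auto intro: bimod_iso_trans)

lemma gbimod_iso_sym: "\<alpha> \<in> alg_auts rscale \<Longrightarrow> gbimod s \<alpha> \<simeq>\<^sub>b N \<Longrightarrow> N \<simeq>\<^sub>b gbimod s \<alpha>"
  using bimodule.bimod_iso_symI [OF bimodule_gbimod] .

text \<open>The constant functions from \<open>nat\<close> carry a copy of the piece.\<close>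

lemma small_gbimod:
  fixes \<alpha> :: "'k::field ralg \<Rightarrow> 'k ralg"
  assumes "\<alpha> \<in> alg_auts rscale"
  obtains N :: "'k ralg small_bimod" where "bimodule rscale N" "N \<simeq>\<^sub>b gbimod s \<alpha>" "gbimod s \<alpha> \<simeq>\<^sub>b N"
proof -
  interpret bimodule rscale "gbimod s \<alpha>"
    using assms by (rule bimodule_gbimod)
  have "inj_on (\<lambda>x _ :: nat. x) (carrier (gbimod s \<alpha>))"
    by (auto simp: inj_on_def fun_eq_iff)
  then show ?thesis
    using that bimodule_copy copy_bimod_iso bimod_iso_symI by blast
qed

lemma pclass_mem: "N \<in> pclass s \<alpha> \<longleftrightarrow> bimodule rscale N \<and> N \<simeq>\<^sub>b gbimod s \<alpha>"
  by (simp add: pclass_def bimod_class_def)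

lemma pclass_nonempty:
  fixes \<alpha> :: "'k::field ralg \<Rightarrow> 'k ralg"
  assumes "\<alpha> \<in> alg_auts rscale"
  shows "pclass s \<alpha> \<noteq> {}"
proof -
  obtain N :: "'k ralg small_bimod" where "bimodule rscale N" "N \<simeq>\<^sub>b gbimod s \<alpha>"
    using small_gbimod [OF assms] .
  then have "N \<in> pclass s \<alpha>"
    by (simp add: pclass_mem)
  then show ?thesis by blast
qed

text \<open>A class holds only small bimodules and not the graded piece itself, so an isomorphism is
  recovered from equal classes by way of a small copy.\<close>

lemma pclass_eq_iff:
  fixes \<alpha> \<beta> :: "'k::field ralg \<Rightarrow> 'k ralg"
  assumes "\<alpha> \<in> alg_auts rscale" "\<beta> \<in> alg_auts rscale"
  shows "pclass s \<alpha> = pclass t \<beta> \<longleftrightarrow> gbimod s \<alpha> \<simeq>\<^sub>b gbimod t \<beta>"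
proof
  assume eq: "pclass s \<alpha> = pclass t \<beta>"
  obtain N :: "'k ralg small_bimod"
    where N: "bimodule rscale N" "N \<simeq>\<^sub>b gbimod s \<alpha>" "gbimod s \<alpha> \<simeq>\<^sub>b N"
    using small_gbimod [OF assms(1)] .
  then have "N \<in> pclass t \<beta>"
    unfolding eq [symmetric] by (simp add: pclass_mem)
  then show "gbimod s \<alpha> \<simeq>\<^sub>b gbimod t \<beta>"
    using N(3) by (auto simp: pclass_mem intro: bimod_iso_trans)
next
  assume iso: "gbimod s \<alpha> \<simeq>\<^sub>b gbimod t \<beta>"
  show "pclass s \<alpha> = pclass t \<beta>"
    unfolding pclass_def by (rule bimod_class_eqI [OF iso gbimod_iso_sym [OF assms(1) iso]])
qed

lemma tensor_iso_gbimod: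
  assumes \<alpha>: "\<alpha> \<in> alg_auts rscale" and \<beta>: "\<beta> \<in> alg_auts rscale" and U: "bimodule rscale U" "U \<simeq>\<^sub>b gbimod s \<alpha>"
    and V: "bimodule rscale V" "V \<simeq>\<^sub>b gbimod t \<beta>"
  shows "tensor_bimod U V \<simeq>\<^sub>b gbimod (s \<noteq> t) (\<alpha> \<circ> \<beta>)"
    and "gbimod (s \<noteq> t) (\<alpha> \<circ> \<beta>) \<simeq>\<^sub>b tensor_bimod U V"
proof -
  interpret bimodule_pair rscale U V
    using U(1) V(1) by (rule bimodule_pairI)
  show *: "T \<simeq>\<^sub>b gbimod (s \<noteq> t) (\<alpha> \<circ> \<beta>)"
    using tensor_cong [OF U(1) V(1) bimodule_gbimod [OF \<alpha>] bimodule_gbimod [OF \<beta>] U(2) V(2)]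
      tensor_gbimod [OF \<alpha> \<beta>]
    by (rule bimod_iso_trans)
  show "gbimod (s \<noteq> t) (\<alpha> \<circ> \<beta>) \<simeq>\<^sub>b T"
    using bimod_iso_sym [OF T.is_group _ _ *] hom_in_carrier [OF tensor_lact_hom] hom_in_carrier [OF tensor_ract_hom]
    by blast
qed

lemma aut_inv:
  assumes "\<alpha> \<in> alg_auts rscale"
  shows "\<alpha> \<circ> inv_into UNIV \<alpha> = id" "inv_into UNIV \<alpha> \<circ> \<alpha> = id"
  using alg_auts_simps(5) [OF assms] by (auto simp: bij_def fun_eq_iff surj_f_inv_f)

text \<open>The inverse of the piece with parameters s and \<alpha> has parameters s and the inverse
  of \<alpha>, since s + s is even.\<close>

lemma invertible_iso_gbimod_iff:
  fixes P :: "'k::field ralg small_bimod"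
  shows "invertible_bimod TYPE(nat \<Rightarrow> 'k ralg) rscale P \<longleftrightarrow>
    bimodule rscale P \<and> (\<exists>s. \<exists>\<alpha> \<in> alg_auts rscale. P \<simeq>\<^sub>b gbimod s \<alpha>)"
proof (intro iffI conjI)
  assume P: "invertible_bimod TYPE(nat \<Rightarrow> 'k ralg) rscale P"
  then show "bimodule rscale P"
    by (simp add: invertible_bimod_def)
  show "\<exists>s. \<exists>\<alpha> \<in> alg_auts rscale. P \<simeq>\<^sub>b gbimod s \<alpha>"
    using invertible_iso_gbimod [OF P] by blast
next
  assume "bimodule rscale P \<and> (\<exists>s. \<exists>\<alpha> \<in> alg_auts rscale. P \<simeq>\<^sub>b gbimod s \<alpha>)"
  then obtain s \<alpha> where P: "bimodule rscale P" and \<alpha>: "\<alpha> \<in> alg_auts rscale" and iso: "P \<simeq>\<^sub>b gbimod s \<alpha>"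
    by blast
  let ?\<beta> = "inv_into UNIV \<alpha>"
  have \<beta>: "?\<beta> \<in> alg_auts rscale"
    using \<alpha> by (rule alg_auts_inv)
  obtain Q :: "'k ralg small_bimod" where Q: "bimodule rscale Q" "Q \<simeq>\<^sub>b gbimod s ?\<beta>"
    using small_gbimod [OF \<beta>] .
  have "tensor_bimod P Q \<simeq>\<^sub>b regular_bimod" "regular_bimod \<simeq>\<^sub>b tensor_bimod Q P"
    using tensor_iso_gbimod(1) [OF \<alpha> \<beta> P iso Q] tensor_iso_gbimod(2) [OF \<beta> \<alpha> Q P iso]
    by (simp_all add: aut_inv [OF \<alpha>] gbimod_False_id)
  then show "invertible_bimod TYPE(nat \<Rightarrow> 'k ralg) rscale P"
    unfolding invertible_bimod_def using P Q(1) by blast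
qed

lemma carrier_Pic: "carrier (Pic rscale) = {pclass s \<alpha> | s \<alpha>. \<alpha> \<in> (alg_auts rscale :: ('k::field ralg \<Rightarrow> _) set)}"
proof (intro equalityI subsetI)
  fix A assume "A \<in> carrier (Pic (rscale :: 'k \<Rightarrow> _))"
  then obtain P :: "'k ralg small_bimod" where P: "invertible_bimod TYPE(nat \<Rightarrow> 'k ralg) rscale P" "A = bimod_class rscale P"
    by (auto simp: Pic_def)
  then obtain s \<alpha> where "bimodule rscale P" "\<alpha> \<in> alg_auts rscale" and iso: "P \<simeq>\<^sub>b gbimod s \<alpha>"
    unfolding invertible_iso_gbimod_iff by blast
  then have "A = pclass s \<alpha>"
    unfolding P(2) pclass_def by (intro bimod_class_eqI [OF iso bimodule.bimod_iso_symI [OF _ iso]])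
  then show "A \<in> {pclass s \<alpha> | s \<alpha>. \<alpha> \<in> alg_auts rscale}"
    using \<open>\<alpha> \<in> alg_auts rscale\<close> by blast
next
  fix A assume "A \<in> {pclass s \<alpha> | s \<alpha>. \<alpha> \<in> (alg_auts rscale :: ('k ralg \<Rightarrow> _) set)}"
  then obtain s and \<alpha> :: "'k ralg \<Rightarrow> 'k ralg" where \<alpha>: "\<alpha> \<in> alg_auts rscale" and A: "A = pclass s \<alpha>"
    by blast
  obtain N :: "'k ralg small_bimod" where N: "bimodule rscale N" "N \<simeq>\<^sub>b gbimod s \<alpha>" "gbimod s \<alpha> \<simeq>\<^sub>b N"
    using small_gbimod [OF \<alpha>] .
  then have "A = bimod_class rscale N"
    unfolding A pclass_def by (intro bimod_class_eqI)
  moreover have "invertible_bimod TYPE(nat \<Rightarrow> 'k ralg) rscale N"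
    unfolding invertible_iso_gbimod_iff using N \<alpha> by blast
  ultimately show "A \<in> carrier (Pic rscale)"
    by (auto simp: Pic_def)
qed

lemma mult_Pic:
  assumes "\<alpha> \<in> (alg_auts rscale :: ('k::field ralg \<Rightarrow> _) set)" "\<beta> \<in> alg_auts rscale"
  shows "pclass s \<alpha> \<otimes>\<^bsub>Pic rscale\<^esub> pclass t \<beta> = pclass (s \<noteq> t) (\<alpha> \<circ> \<beta>)"
proof -
  have "bimod_class rscale (tensor_bimod U V) = pclass (s \<noteq> t) (\<alpha> \<circ> \<beta>)"
    if "U \<in> pclass s \<alpha>" "V \<in> pclass t \<beta>" for U V
    using that [unfolded pclass_mem] unfolding pclass_def
    by (elim conjE) (intro bimod_class_eqI tensor_iso_gbimod [OF assms])
  \<comment> \<open>The product is a union over representatives, which would be empty for an empty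
    class.\<close>
  moreover have "pclass s \<alpha> \<noteq> {}" "pclass t \<beta> \<noteq> {}"
    using pclass_nonempty assms by blast+
  ultimately show ?thesis
    by (simp add: Pic_def)
qed

lemma one_Pic: "\<one>\<^bsub>Pic rscale\<^esub> = pclass False id"
  by (simp add: Pic_def pclass_def gbimod_False_id)

section \<open>Which graded pieces are isomorphic to the regular bimodule\<close>

lemma odd_not_iso_regular: "\<not> gbimod True \<alpha> \<simeq>\<^sub>b (regular_bimod :: ('k::field ralg, 'k ralg) bimod)"
proof
  assume "gbimod True \<alpha> \<simeq>\<^sub>b (regular_bimod :: ('k ralg, 'k ralg) bimod)"
  then obtain f where f: "f \<in> iso (gbimod True \<alpha>) (regular_bimod :: ('k ralg, 'k ralg) bimod)"
    and fl: "\<And>r d. f (gmul False True r d) = r * f d"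
    unfolding bimod_iso_def by auto
  then have "bij f"
    by (simp add: iso_def)
  \<comment> \<open>f sends r d to r, so no nonzero r annihilates d.\<close>
  then obtain d where d: "f d = 1"
    by (metis bij_pointE)
  have 1: "r = 0" if "gmul False True r d = 0" for r
  proof -
    have "r = f (gmul False True r d)"
      using fl [of r d] d by simp
    also have "\<dots> = 0"
      using fl [of 0 d] that by simp
    finally show ?thesis .
  qed
  let ?y1 = "coord d (BY I1)" and ?y2 = "coord d (BY I2)"
  \<comment> \<open>In \<open>R d\<close> the entries \<open>X\<^sub>i\<close> of \<open>R\<close> only meet the entries \<open>Y\<^sub>i\<close> of \<open>d\<close>.\<close>
  have *: "gmul False True (rscale a (basis_elem (BX I1)) + rscale b (basis_elem (BX I2))) d = 0"
    if "a * ?y1 + b * ?y2 = 0" for a b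
    using that by (simp add: ralg_eq_iff gmul_def coord_basis_elem)
  have "a = 0 \<and> b = 0" if "a * ?y1 + b * ?y2 = 0" for a b
    using 1 [OF * [OF that]] by (simp add: ralg_eq_iff coord_basis_elem)
  \<comment> \<open>The pair (y2, -y1) is a solution, so y1 and y2 vanish; then (1, 0) is a solution
    too, a contradiction.\<close>
  from this [of ?y2 "- ?y1"] this [of 1 0] this [of 0 1] show False
    by auto
qed

text \<open>An isomorphism f is right multiplication by the unit u = f(1), and right linearity then
  reads \<alpha>(r) u = u r.\<close>

lemma even_iso_regular_iff:
  assumes "\<alpha> \<in> alg_auts rscale"
  shows "gbimod False \<alpha> \<simeq>\<^sub>b regular_bimod \<longleftrightarrow> \<alpha> \<in> Inn_alg"
proof
  assume "gbimod False \<alpha> \<simeq>\<^sub>b regular_bimod"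
  then obtain f where f: "f \<in> iso (gbimod False \<alpha>) regular_bimod"
    and fl: "\<And>r m. f (r * m) = r * f m" and fr: "\<And>r m. f (m * \<alpha> r) = f m * r"
    unfolding bimod_iso_def gbimod_simps regular_bimod_simps gmul_False by blast
  then have "bij f"
    by (simp add: iso_def)
  have u: "f r = r * f 1" for r
    using fl [of r 1] by simp
  obtain v where v: "v * f 1 = 1"
    using \<open>bij f\<close> u by (metis bij_pointE)
  \<comment> \<open>So far v is only a left inverse of f 1; injectivity of f makes it
    two-sided.\<close>
  have "f (f 1 * v) = f 1"
    using u [of "f 1 * v"] v by (simp add: mult.assoc)
  then have uv: "f 1 * v = 1"
    using \<open>bij f\<close> by (metis bij_def injD)
  have "\<alpha> r = f 1 * r * v" for r
    using fr [of 1 r] u [of "\<alpha> r"] uv by (metis mult.assoc mult_1 mult_1_right)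
  then have "\<alpha> = (\<lambda>r. f 1 * r * v)"
    by auto
  then show "\<alpha> \<in> Inn_alg"
    unfolding Inn_alg_def using v uv by blast
next
  assume "\<alpha> \<in> Inn_alg"
  then obtain u v where uv: "u * v = 1" "v * u = 1" and \<alpha>: "\<alpha> = (\<lambda>r. v * r * u)"
    unfolding Inn_alg_def by blast
  let ?f = "\<lambda>r. r * v"
  have "bij ?f"
    by (rule bij_betw_byWitness [where f' = "\<lambda>r. r * u"]) (auto simp: mult.assoc uv)
  then have "?f \<in> iso (gbimod False \<alpha>) regular_bimod"
    by (auto simp: iso_def hom_def distrib_right)
  then show "gbimod False \<alpha> \<simeq>\<^sub>b regular_bimod"
    unfolding bimod_iso_def
    by (intro bexI [of _ ?f]) (simp_all add: \<alpha> mult.assoc uv)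
qed

lemma pclass_eq_one_iff:
  assumes "\<alpha> \<in> alg_auts rscale"
  shows "pclass s \<alpha> = pclass False id \<longleftrightarrow> \<not> s \<and> \<alpha> \<in> Inn_alg"
  using pclass_eq_iff [OF assms alg_auts_id, of s False] odd_not_iso_regular [of \<alpha>] even_iso_regular_iff [OF assms]
  unfolding gbimod_False_id by (cases s) auto

section \<open>The Picard group as a quotient of Aut x C_2\<close>

abbreviation (input) Z2 :: "int monoid" where "Z2 \<equiv> integer_mod_group 2"

definition pic_hom :: "('k::field ralg \<Rightarrow> 'k ralg) \<times> int \<Rightarrow> 'k ralg small_bimod set" where
  "pic_hom = (\<lambda>(\<alpha>, n). pclass (n = 1) \<alpha>)"

lemma carrier_Aut_Z2: "carrier (Aut_alg rscale \<times>\<times> Z2) = alg_auts rscale \<times> {0, 1}"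
  by (auto simp: Aut_alg_def carrier_integer_mod_group)

lemma pic_hom_hom: "pic_hom \<in> hom (Aut_alg rscale \<times>\<times> Z2) (Pic (rscale :: 'k::field \<Rightarrow> _))"
proof (rule homI)
  fix x y :: "('k ralg \<Rightarrow> 'k ralg) \<times> int"
  assume "x \<in> carrier (Aut_alg rscale \<times>\<times> Z2)" "y \<in> carrier (Aut_alg rscale \<times>\<times> Z2)"
  then obtain \<alpha> m \<beta> n where "x = (\<alpha>, m)" "y = (\<beta>, n)" "\<alpha> \<in> alg_auts rscale" "\<beta> \<in> alg_auts rscale" "m \<in> {0, 1}" "n \<in> {0, 1}"
    unfolding carrier_Aut_Z2 by blast
  then show "pic_hom (x \<otimes>\<^bsub>Aut_alg rscale \<times>\<times> Z2\<^esub> y) = pic_hom x \<otimes>\<^bsub>Pic rscale\<^esub> pic_hom y"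
    by (auto simp: pic_hom_def mult_Pic Aut_alg_def)
qed (unfold carrier_Aut_Z2 carrier_Pic, auto simp: pic_hom_def)

lemma pic_hom_surj: "pic_hom ` carrier (Aut_alg rscale \<times>\<times> Z2) = carrier (Pic (rscale :: 'k::field \<Rightarrow> _))"
proof
  show "carrier (Pic (rscale :: 'k \<Rightarrow> _)) \<subseteq> pic_hom ` carrier (Aut_alg rscale \<times>\<times> Z2)"
  proof
    fix A assume "A \<in> carrier (Pic (rscale :: 'k \<Rightarrow> _))"
    then obtain s and \<alpha> :: "'k ralg \<Rightarrow> 'k ralg" where "\<alpha> \<in> alg_auts rscale" "A = pclass s \<alpha>"
      unfolding carrier_Pic by blast
    then show "A \<in> pic_hom ` carrier (Aut_alg rscale \<times>\<times> Z2)"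
      unfolding carrier_Aut_Z2
      by (intro image_eqI [of _ _ "(\<alpha>, if s then 1 else 0)"]) (auto simp: pic_hom_def)
  qed
qed (use hom_in_carrier [OF pic_hom_hom] in blast)

text \<open>The axioms are inherited from Aut x C_2 along the surjective homomorphism
  \<open>pic_hom\<close>, instead of being checked on tensor products.\<close>

lemma group_Pic: "group (Pic (rscale :: 'k::field \<Rightarrow> _))"
proof -
  interpret AZ: group "Aut_alg (rscale :: 'k \<Rightarrow> _) \<times>\<times> Z2"
    by (rule DirProd_group [OF group_Aut group_integer_mod_group])
  have "pic_hom \<one>\<^bsub>Aut_alg rscale \<times>\<times> Z2\<^esub> = \<one>\<^bsub>Pic (rscale :: 'k \<Rightarrow> _)\<^esub>"
    by (simp add: pic_hom_def one_Pic Aut_alg_def)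
  then show ?thesis
    using AZ.hom_imp_img_group [OF pic_hom_hom] unfolding pic_hom_surj by simp
qed

lemma Inn_alg_subset: "Inn_alg \<subseteq> (alg_auts rscale :: ('k::field ralg \<Rightarrow> _) set)"
proof
  fix \<alpha> :: "'k ralg \<Rightarrow> 'k ralg"
  assume "\<alpha> \<in> Inn_alg"
  then obtain u v where uv: "u * v = 1" "v * u = 1" and \<alpha>: "\<alpha> = (\<lambda>r. v * r * u)"
    unfolding Inn_alg_def by blast
  have c: "v * (u * r) = r" "u * (v * r) = r" for r
    using uv by (simp_all flip: mult.assoc)
  show "\<alpha> \<in> alg_auts rscale"
  proof (rule alg_autsI)
    show "bij \<alpha>"
      by (rule bij_betw_byWitness [where f' = "\<lambda>r. u * r * v"]) (auto simp: \<alpha> mult.assoc uv c)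
    show "\<alpha> (rscale k r) = rscale k (\<alpha> r)" for k r
      using gmul_scale [of False False, where 'a = 'k] by (simp add: \<alpha>)
  qed (simp_all add: \<alpha> distrib_left distrib_right mult.assoc uv c)
qed

lemma pclass_Inn: "\<alpha> \<in> Inn_alg \<Longrightarrow> pclass False \<alpha> = pclass False id"
  by (simp add: pclass_eq_one_iff subsetD [OF Inn_alg_subset])

lemma kernel_pic_hom:
  "kernel (Aut_alg rscale \<times>\<times> Z2) (Pic (rscale :: 'k::field \<Rightarrow> _)) pic_hom = Inn_alg \<times> {\<one>\<^bsub>Z2\<^esub>}"
  unfolding kernel_def carrier_Aut_Z2 
  by (auto simp: pic_hom_def one_Pic pclass_eq_one_iff pclass_Inn dest: subsetD [OF Inn_alg_subset])

text \<open>It is the kernel of \<alpha> \<mapsto> \<open>pclass False \<alpha>\<close>, so no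
  conjugate has to be computed.\<close>

lemma Inn_alg_normal: "Inn_alg \<lhd> Aut_alg (rscale :: 'k::field \<Rightarrow> _)"
proof -
  have "(\<lambda>\<alpha>. pclass False \<alpha>) \<in> hom (Aut_alg rscale) (Pic (rscale :: 'k \<Rightarrow> _))"
    by (rule homI) (auto simp: Aut_alg_def mult_Pic carrier_Pic)
  then interpret group_hom "Aut_alg (rscale :: 'k \<Rightarrow> _)" "Pic (rscale :: 'k \<Rightarrow> _)" "\<lambda>\<alpha>. pclass False \<alpha>"
    by (intro group_hom.intro group_Aut group_Pic group_hom_axioms.intro)
  have "kernel (Aut_alg rscale) (Pic (rscale :: 'k \<Rightarrow> _)) (\<lambda>\<alpha>. pclass False \<alpha>) = Inn_alg"
    by (auto simp: kernel_def one_Pic pclass_eq_one_iff pclass_Inn Aut_alg_def dest: subsetD [OF Inn_alg_subset])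
  then show ?thesis
    using normal_kernel by simp
qed

lemma Pic_iso: "Pic (rscale :: 'k::field \<Rightarrow> _) \<cong> Out_alg (rscale :: 'k \<Rightarrow> _) \<times>\<times> Z2"
proof -
  let ?A = "Aut_alg (rscale :: 'k \<Rightarrow> _)"
  interpret A: group ?A by (rule group_Aut)
  interpret Z: group Z2 by simp
  interpret h: group_hom "?A \<times>\<times> Z2" "Pic (rscale :: 'k \<Rightarrow> _)" pic_hom
    by (intro group_hom.intro DirProd_group group_Aut group_integer_mod_group group_Pic
        group_hom_axioms.intro pic_hom_hom)
  interpret O: group "Out_alg (rscale :: 'k \<Rightarrow> _)"
    unfolding Out_alg_def by (rule normal.factorgroup_is_group [OF Inn_alg_normal])
  \<comment> \<open>The factor C_2 is replaced by its quotient by the trivial subgroup, so that a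
    product of two quotients becomes a quotient of the product, by exactly the kernel of
    \<open>pic_hom\<close>.\<close>
  have "Out_alg (rscale :: 'k \<Rightarrow> _) \<times>\<times> Z2 \<cong> (?A Mod Inn_alg) \<times>\<times> (Z2 Mod {\<one>\<^bsub>Z2\<^esub>})"
    unfolding Out_alg_def [symmetric]
    by (rule O.DirProd_iso_trans [OF iso_refl group.iso_sym [OF normal.factorgroup_is_group [OF Z.one_is_normal]
            is_isoI [OF Z.trivial_factor_iso]]])
  also have "\<dots> \<cong> (?A \<times>\<times> Z2) Mod (Inn_alg \<times> {\<one>\<^bsub>Z2\<^esub>})"
    using A.FactGroup_DirProd_multiplication_iso_set [OF Z.is_group Inn_alg_normal Z.one_is_normal]
    by (rule is_isoI)
  also have "\<dots> \<cong> Pic (rscale :: 'k \<Rightarrow> _)"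
    using h.FactGroup_iso [OF pic_hom_surj] unfolding kernel_pic_hom .
  finally show ?thesis
    using group.iso_sym [OF DirProd_group [OF O.is_group Z.is_group]] by blast
qed

theorem theoremB:
  "group (Pic (rscale :: 'k::field \<Rightarrow> 'k ralg \<Rightarrow> 'k ralg)) \<and>
   bimod_class rscale (dual_bimod rscale) \<in> carrier (Pic (rscale :: 'k \<Rightarrow> 'k ralg \<Rightarrow> 'k ralg)) \<and>
   group.ord (Pic rscale) (bimod_class rscale (dual_bimod (rscale :: 'k \<Rightarrow> 'k ralg \<Rightarrow> 'k ralg))) = 2 \<and>
   (\<forall>P :: ('k ralg, 'p) bimod.
      invertible_bimod TYPE('q) (rscale :: 'k \<Rightarrow> 'k ralg \<Rightarrow> 'k ralg) P \<longrightarrow>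
      (\<exists>\<alpha> \<in> alg_auts (rscale :: 'k \<Rightarrow> 'k ralg \<Rightarrow> 'k ralg).
         P \<simeq>\<^sub>b twist_bimod regular_bimod \<alpha> \<or>
         P \<simeq>\<^sub>b twist_bimod (dual_bimod (rscale :: 'k \<Rightarrow> 'k ralg \<Rightarrow> 'k ralg)) \<alpha>)) \<and>
   Pic (rscale :: 'k \<Rightarrow> 'k ralg \<Rightarrow> 'k ralg) \<cong>
     Out_alg (rscale :: 'k \<Rightarrow> 'k ralg \<Rightarrow> 'k ralg) \<times>\<times> integer_mod_group 2"
proof (intro conjI allI impI)
  let ?P = "Pic (rscale :: 'k \<Rightarrow> 'k ralg \<Rightarrow> 'k ralg)"
  interpret Pic: group ?P by (rule group_Pic)
  have D: "bimod_class rscale (dual_bimod rscale) = pclass True (id :: 'k ralg \<Rightarrow> 'k ralg)"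
    unfolding pclass_def
    by (rule bimod_class_eqI [OF gbimod_iso_sym [OF alg_auts_id gbimod_True_id] gbimod_True_id])
  show mem: "bimod_class rscale (dual_bimod rscale) \<in> carrier ?P"
    unfolding D carrier_Pic using alg_auts_id by blast
  have "pclass True id \<noteq> \<one>\<^bsub>?P\<^esub>"
    unfolding one_Pic by (simp add: pclass_eq_one_iff alg_auts_id)
  \<comment> \<open>Odd plus odd is even, so the square of the class of the dual is the class of the
    regular bimodule.\<close>
  moreover have "pclass True id [^]\<^bsub>?P\<^esub> (2::nat) = \<one>\<^bsub>?P\<^esub>"
    using mem by (simp add: D numeral_2_eq_2 mult_Pic alg_auts_id one_Pic)
  ultimately show "group.ord ?P (bimod_class rscale (dual_bimod rscale)) = 2"
    using Pic.pow_eq_id [OF mem, of 2] Pic.ord_eq_1 [OF mem] unfolding D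
    by (metis One_nat_def prime_nat_iff two_is_prime_nat)
  show "\<exists>\<alpha> \<in> alg_auts (rscale :: 'k \<Rightarrow> 'k ralg \<Rightarrow> 'k ralg).
      P \<simeq>\<^sub>b twist_bimod regular_bimod \<alpha> \<or> P \<simeq>\<^sub>b twist_bimod (dual_bimod rscale) \<alpha>"
    if "invertible_bimod TYPE('q) (rscale :: 'k \<Rightarrow> 'k ralg \<Rightarrow> 'k ralg) P" for P :: "('k ralg, 'p) bimod"
  proof -
    obtain s \<alpha> where \<alpha>: "\<alpha> \<in> alg_auts rscale" "P \<simeq>\<^sub>b gbimod s \<alpha>"
      using invertible_iso_gbimod [OF \<open>invertible_bimod TYPE('q) rscale P\<close>] .
    then have "P \<simeq>\<^sub>b twist_bimod regular_bimod \<alpha> \<or> P \<simeq>\<^sub>b twist_bimod (dual_bimod rscale) \<alpha>"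
      using bimod_iso_trans [OF _ gbimod_True] by (cases s) (auto simp: gbimod_False)
    with \<alpha>(1) show ?thesis by blast
  qed
qed (rule group_Pic Pic_iso)+

end
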